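(* Let $\mathbb K$ be a field and $d\ge 0$ an integer. Let $\rho$ be the map from the set of isomorphism classes of TH systems over $\mathbb K$ of diameter $d$ to the set of normalized west-south Vandermonde systems in $\mathrm{Mat}_{d+1}(\mathbb K)$ which sends the isomorphism class of a TH system $\Phi$ with eigenvalue sequence $\{\theta_i\}_{i=0}^d$, dual eigenvalue sequence $\{\theta^*_i\}_{i=0}^d$ and west-south normalized transition matrix $\mathcal P$ to $(\mathcal P,\{\theta_i\}_{i=0}^d,\{\theta^*_i\}_{i=0}^d)$. Let $\chi$ be the map in the opposite direction which sends a normalized west-south Vandermonde system $(X,\{\theta_i\}_{i=0}^d,\{\theta_i^*\}_{i=0}^d)$ to the isomorphism class of the TH system constructed from it (as described in the context). Then $\rho$ and $\chi$ are inverses of each other. Moreover each of $\rho$, $\chi$ is bijective.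
   Context: Rows and columns of matrices in $\mathrm{Mat}_{d+1}(\mathbb K)$ are indexed by $0,\dots,d$. The symbol $*$ is only notation (no conjugate-transpose). Let $V$ be a $\mathbb K$-vector space of dimension $d+1$. An element of $\mathrm{End}(V)$ is multiplicity-free if it is diagonalizable and all its eigenspaces have dimension one; the primitive idempotent attached to an eigenspace acts as the identity on it and as $0$ on the other eigenspaces. A TH system on $V$ (of diameter $d$, over $\mathbb K$) is a sequence $\Phi=(A;\{E_i\}_{i=0}^d;A^*;\{E^*_i\}_{i=0}^d)$ such that $A,A^*\in\mathrm{End}(V)$ are multiplicity-free; $\{E_i\}$ (resp. $\{E_i^*\}$) is an ordering of the primitive idempotents of $A$ (resp. $A^*$); and for $0\le i,j\le d$, each of $E_iA^*E_j$ and $E^*_iAE^*_j$ is $0$ if $i-j>1$ and nonzero if $i-j=1$. The eigenvalue sequence $\{\theta_i\}$ (resp. dual eigenvalue sequence $\{\theta_i^*\}$): $\theta_i$ (resp. $\theta_i^*$) is the eigenvalue of $A$ (resp. $A^*$) corresponding to $E_i$ (resp. $E_i^*$). TH systems $(A;\{E_i\};A^*;\{E_i^*\})$ on $V$ and $(B;\{F_i\};B^*;\{F_i^*\})$ on $W$ are isomorphic if there is a $\mathbb K$-algebra isomorphism $\gamma:\mathrm{End}(V)\to\mathrm{End}(W)$ with $B=A^\gamma$, $B^*=A^{*\gamma}$, $F_i=E_i^\gamma$, $F_i^*=E_i^{*\gamma}$ for all $i$. Split sequence: for $0\le i\le d$ put $U_i=(E^*_0V+\cdots+E^*_iV)\cap(E_0V+\cdots+E_{d-i}V)$.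 It is known that the $U_i$ are one-dimensional, $V=\bigoplus_i U_i$, and (with $U_{-1}=U_{d+1}=0$) $(A-\theta_{d-i}I)U_i=U_{i+1}$, $(A^*-\theta^*_iI)U_i=U_{i-1}$. For $1\le i\le d$, $\phi_i$ is the (nonzero) eigenvalue of $(A-\theta_{d-i+1}I)(A^*-\theta_i^*I)$ on $U_i$. West-south normalized transition matrix $\mathcal P\in\mathrm{Mat}_{d+1}(\mathbb K)$ of $\Phi$: $$\mathcal P_{ij}=\sum_{h=0}^d\frac{(\theta_i-\theta_d)(\theta_i-\theta_{d-1})\cdots(\theta_i-\theta_{d-h+1})\,(\theta_j^*-\theta_0^* )(\theta_j^*-\theta_1^* )\cdots(\theta_j^*-\theta_{h-1}^* )}{\phi_1\phi_2\cdots\phi_h}.$$ A sequence of polynomials $\{f_i\}_{i=0}^d$ in $\mathbb K[\lambda]$ is graded if $f_0=1$ and $\deg f_i=i$. A normalized west-south Vandermonde system in $\mathrm{Mat}_{d+1}(\mathbb K)$ is a sequence $(X,\{\theta_i\}_{i=0}^d,\{\theta^*_i\}_{i=0}^d)$ where $X\in\mathrm{Mat}_{d+1}(\mathbb K)$, $\{\theta_i\}$ are mutually distinct scalars in $\mathbb K$, $\{\theta_i^*\}$ are mutually distinct scalars in $\mathbb K$, there is a graded sequence $\{f_i\}_{i=0}^d$ with $X_{ij}=f_j(\theta_i)$ for all $i,j$, and there is a graded sequence $\{f_i^*\}_{i=0}^d$ with $X_{ij}=f^*_{d-i}(\theta^*_j)$ for all $i,j$. (In particular $X_{i0}=1=X_{di}$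 for all $i$, and $X$ is invertible.) For every TH system $\Phi$, $(\mathcal P,\{\theta_i\},\{\theta_i^*\})$ is such a system, so $\rho$ is well defined. Construction defining $\chi$: given a normalized west-south Vandermonde system $(X,\{\theta_i\},\{\theta_i^*\})$, choose bases $\{u_i\}_{i=0}^d$, $\{v_i\}_{i=0}^d$ of a $(d+1)$-dimensional space $V$ with $v_j=\sum_{i}X_{ij}u_i$ for all $j$. Define $A,A^*\in\mathrm{End}(V)$ by $Au_i=\theta_iu_i$ and $A^*v_i=\theta_i^*v_i$, and let $E_i$ (resp. $E_i^*$) be the primitive idempotent of $A$ (resp. $A^*$) for $\theta_i$ (resp. $\theta_i^*$). Then $(A;\{E_i\};A^*;\{E_i^*\})$ is a TH system on $V$, and $\chi$ sends the given system to its isomorphism class. *)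

theory Defs
  imports Complex_Main "HOL-Library.FuncSet" "HOL-Computational_Algebra.Polynomial"
    "Jordan_Normal_Form.Matrix"
begin

text \<open>A TH system carries its underlying vector space. Sequences indexed by \<open>0,\<dots>,d\<close> are
  lists of length \<open>d + 1\<close>. The vector spaces are the \<open>(d + 1)\<close>-dimensional subspaces of an
  arbitrary ambient vector space with scalar multiplication \<open>scale\<close>, and an endomorphism of
  the subspace \<open>V\<close> is an extensional function (\<open>undefined\<close> outside \<open>V\<close>), so that equality in
  \<open>End(V)\<close> is equality of functions.\<close>

record 'v th_sys =
  th_space :: "'v set"
  th_A :: "'v \<Rightarrow> 'v"
  th_E :: "('v \<Rightarrow> 'v) list"
  th_As :: "'v \<Rightarrow> 'v"
  th_Es :: "('v \<Rightarrow> 'v) list"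

definition graded :: "nat \<Rightarrow> (nat \<Rightarrow> 'a::field poly) \<Rightarrow> bool" where
  "graded d f \<longleftrightarrow> f 0 = 1 \<and> (\<forall>i\<le>d. degree (f i) = i)"

definition nws_vandermonde :: "nat \<Rightarrow> ('a::field mat \<times> 'a list \<times> 'a list) set" where
  "nws_vandermonde d = {(X, \<theta>, \<theta>s).
     X \<in> carrier_mat (Suc d) (Suc d) \<and>
     length \<theta> = Suc d \<and> distinct \<theta> \<and> length \<theta>s = Suc d \<and> distinct \<theta>s \<and>
     (\<exists>f. graded d f \<and> (\<forall>i\<le>d. \<forall>j\<le>d. X $$ (i, j) = poly (f j) (\<theta> ! i))) \<and>
     (\<exists>fs. graded d fs \<and> (\<forall>i\<le>d. \<forall>j\<le>d. X $$ (i, j) = poly (fs (d - i)) (\<theta>s ! j)))}"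

definition End ::
  "('a::field \<Rightarrow> 'v::ab_group_add \<Rightarrow> 'v) \<Rightarrow> 'v set \<Rightarrow> ('v \<Rightarrow> 'v) set" where
  "End scale V = {f \<in> V \<rightarrow>\<^sub>E V.
     (\<forall>x\<in>V. \<forall>y\<in>V. f (x + y) = f x + f y) \<and>
     (\<forall>c. \<forall>x\<in>V. f (scale c x) = scale c (f x))}"

definition algebra_iso ::
  "('a::field \<Rightarrow> 'v::ab_group_add \<Rightarrow> 'v) \<Rightarrow> 'v set \<Rightarrow> 'v set \<Rightarrow> (('v \<Rightarrow> 'v) \<Rightarrow> ('v \<Rightarrow> 'v)) \<Rightarrow> bool" where
  "algebra_iso scale V W \<gamma> \<longleftrightarrow> bij_betw \<gamma> (End scale V) (End scale W) \<and>
     (\<forall>f\<in>End scale V. \<forall>g\<in>End scale V. \<gamma> (\<lambda>x\<in>V. f x + g x) = (\<lambda>x\<in>W. \<gamma> f x + \<gamma> g x)) \<and>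
     (\<forall>c. \<forall>f\<in>End scale V. \<gamma> (\<lambda>x\<in>V. scale c (f x)) = (\<lambda>x\<in>W. scale c (\<gamma> f x))) \<and>
     (\<forall>f\<in>End scale V. \<forall>g\<in>End scale V. \<gamma> (compose V f g) = compose W (\<gamma> f) (\<gamma> g)) \<and>
     \<gamma> (\<lambda>x\<in>V. x) = (\<lambda>x\<in>W. x)"

definition eigenspace ::
  "('a::field \<Rightarrow> 'v::ab_group_add \<Rightarrow> 'v) \<Rightarrow> 'v set \<Rightarrow> ('v \<Rightarrow> 'v) \<Rightarrow> 'a \<Rightarrow> 'v set" where
  "eigenspace scale V A c = {x \<in> V. A x = scale c x}"

definition is_eigenvalue ::
  "('a::field \<Rightarrow> 'v::ab_group_add \<Rightarrow> 'v) \<Rightarrow> 'v set \<Rightarrow> ('v \<Rightarrow> 'v) \<Rightarrow> 'a \<Rightarrow> bool" where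
  "is_eigenvalue scale V A c \<longleftrightarrow> eigenspace scale V A c \<noteq> {0}"

definition diagonalizable ::
  "('a::field \<Rightarrow> 'v::ab_group_add \<Rightarrow> 'v) \<Rightarrow> 'v set \<Rightarrow> ('v \<Rightarrow> 'v) \<Rightarrow> bool" where
  "diagonalizable scale V A \<longleftrightarrow>
     (\<exists>B. \<not> module.dependent scale B \<and> module.span scale B = V \<and> (\<forall>b\<in>B. \<exists>c. A b = scale c b))"

definition multiplicity_free ::
  "('a::field \<Rightarrow> 'v::ab_group_add \<Rightarrow> 'v) \<Rightarrow> 'v set \<Rightarrow> ('v \<Rightarrow> 'v) \<Rightarrow> bool" where
  "multiplicity_free scale V A \<longleftrightarrow> A \<in> End scale V \<and> diagonalizable scale V A \<and>
     (\<forall>c. is_eigenvalue scale V A c \<longrightarrow> vector_space.dim scale (eigenspace scale V A c) = 1)"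

definition primitive_idempotent ::
  "('a::field \<Rightarrow> 'v::ab_group_add \<Rightarrow> 'v) \<Rightarrow> 'v set \<Rightarrow> ('v \<Rightarrow> 'v) \<Rightarrow> 'a \<Rightarrow> ('v \<Rightarrow> 'v) \<Rightarrow> bool" where
  "primitive_idempotent scale V A c P \<longleftrightarrow> is_eigenvalue scale V A c \<and> P \<in> End scale V \<and>
     (\<forall>x\<in>eigenspace scale V A c. P x = x) \<and>
     (\<forall>c'. c' \<noteq> c \<longrightarrow> (\<forall>x\<in>eigenspace scale V A c'. P x = 0))"

definition idempotent_ordering ::
  "('a::field \<Rightarrow> 'v::ab_group_add \<Rightarrow> 'v) \<Rightarrow> 'v set \<Rightarrow> ('v \<Rightarrow> 'v) \<Rightarrow> ('v \<Rightarrow> 'v) list \<Rightarrow> bool" where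
  "idempotent_ordering scale V A E \<longleftrightarrow> distinct E \<and> set E = {P. \<exists>c. primitive_idempotent scale V A c P}"

definition TH_systems ::
  "('a::field \<Rightarrow> 'v::ab_group_add \<Rightarrow> 'v) \<Rightarrow> nat \<Rightarrow> 'v th_sys set" where
  "TH_systems scale d = {\<Phi>. let V = th_space \<Phi>; A = th_A \<Phi>; E = th_E \<Phi>; As = th_As \<Phi>; Es = th_Es \<Phi> in
     module.subspace scale V \<and> vector_space.dim scale V = Suc d \<and>
     multiplicity_free scale V A \<and> multiplicity_free scale V As \<and>
     length E = Suc d \<and> idempotent_ordering scale V A E \<and>
     length Es = Suc d \<and> idempotent_ordering scale V As Es \<and>
     (\<forall>i\<le>d. \<forall>j\<le>d.
        (i > j + 1 \<longrightarrow> compose V (E ! i) (compose V As (E ! j)) = (\<lambda>x\<in>V. 0) \<and>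
                      compose V (Es ! i) (compose V A (Es ! j)) = (\<lambda>x\<in>V. 0)) \<and>
        (i = j + 1 \<longrightarrow> compose V (E ! i) (compose V As (E ! j)) \<noteq> (\<lambda>x\<in>V. 0) \<and>
                      compose V (Es ! i) (compose V A (Es ! j)) \<noteq> (\<lambda>x\<in>V. 0)))}"

definition TH_iso ::
  "('a::field \<Rightarrow> 'v::ab_group_add \<Rightarrow> 'v) \<Rightarrow> nat \<Rightarrow> ('v th_sys \<times> 'v th_sys) set" where
  "TH_iso scale d = {(\<Phi>, \<Psi>). \<Phi> \<in> TH_systems scale d \<and> \<Psi> \<in> TH_systems scale d \<and>
     (\<exists>\<gamma>. algebra_iso scale (th_space \<Phi>) (th_space \<Psi>) \<gamma> \<and>
        th_A \<Psi> = \<gamma> (th_A \<Phi>) \<and> th_As \<Psi> = \<gamma> (th_As \<Phi>) \<and>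
        (\<forall>i\<le>d. th_E \<Psi> ! i = \<gamma> (th_E \<Phi> ! i) \<and> th_Es \<Psi> ! i = \<gamma> (th_Es \<Phi> ! i)))}"

definition TH_class ::
  "('a::field \<Rightarrow> 'v::ab_group_add \<Rightarrow> 'v) \<Rightarrow> nat \<Rightarrow> 'v th_sys \<Rightarrow> 'v th_sys set" where
  "TH_class scale d \<Phi> = TH_iso scale d `` {\<Phi>}"

definition TH_classes ::
  "('a::field \<Rightarrow> 'v::ab_group_add \<Rightarrow> 'v) \<Rightarrow> nat \<Rightarrow> 'v th_sys set set" where
  "TH_classes scale d = TH_systems scale d // TH_iso scale d"

definition eig ::
  "('a::field \<Rightarrow> 'v::ab_group_add \<Rightarrow> 'v) \<Rightarrow> 'v th_sys \<Rightarrow> nat \<Rightarrow> 'a" where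
  "eig scale \<Phi> i = (THE c. primitive_idempotent scale (th_space \<Phi>) (th_A \<Phi>) c (th_E \<Phi> ! i))"

definition dual_eig ::
  "('a::field \<Rightarrow> 'v::ab_group_add \<Rightarrow> 'v) \<Rightarrow> 'v th_sys \<Rightarrow> nat \<Rightarrow> 'a" where
  "dual_eig scale \<Phi> i = (THE c. primitive_idempotent scale (th_space \<Phi>) (th_As \<Phi>) c (th_Es \<Phi> ! i))"

definition split_space :: "nat \<Rightarrow> 'v::ab_group_add th_sys \<Rightarrow> nat \<Rightarrow> 'v set" where
  "split_space d \<Phi> i =
     {(\<Sum>k\<le>i. x k) | x. \<forall>k\<le>i. x k \<in> (th_Es \<Phi> ! k) ` th_space \<Phi>} \<inter>
     {(\<Sum>k\<le>d - i. x k) | x. \<forall>k\<le>d - i. x k \<in> (th_E \<Phi> ! k) ` th_space \<Phi>}"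

text \<open>Only meaningful for \<open>1 \<le> i \<le> d\<close>; \<open>y\<close> below is \<open>(A\<^sup>* - \<theta>\<^sup>*\<^sub>i I) x\<close>.\<close>
definition split_eig ::
  "('a::field \<Rightarrow> 'v::ab_group_add \<Rightarrow> 'v) \<Rightarrow> nat \<Rightarrow> 'v th_sys \<Rightarrow> nat \<Rightarrow> 'a" where
  "split_eig scale d \<Phi> i = (THE c. \<forall>x\<in>split_space d \<Phi> i.
     (let y = th_As \<Phi> x - scale (dual_eig scale \<Phi> i) x
      in th_A \<Phi> y - scale (eig scale \<Phi> (d - i + 1)) y) = scale c x)"

definition transition_matrix ::
  "('a::field \<Rightarrow> 'v::ab_group_add \<Rightarrow> 'v) \<Rightarrow> nat \<Rightarrow> 'v th_sys \<Rightarrow> 'a mat" where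
  "transition_matrix scale d \<Phi> = mat (Suc d) (Suc d) (\<lambda>(i, j). \<Sum>h\<le>d.
     ((\<Prod>k<h. eig scale \<Phi> i - eig scale \<Phi> (d - k)) * (\<Prod>k<h. dual_eig scale \<Phi> j - dual_eig scale \<Phi> k))
       / (\<Prod>k=1..h. split_eig scale d \<Phi> k))"

definition rho_rep ::
  "('a::field \<Rightarrow> 'v::ab_group_add \<Rightarrow> 'v) \<Rightarrow> nat \<Rightarrow> 'v th_sys \<Rightarrow> 'a mat \<times> 'a list \<times> 'a list" where
  "rho_rep scale d \<Phi> =
     (transition_matrix scale d \<Phi>, map (eig scale \<Phi>) [0..<Suc d], map (dual_eig scale \<Phi>) [0..<Suc d])"

text \<open>\<open>the_elem\<close> is harmless here and in \<open>chi\<close> only if the image is a singleton, i.e. if the map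
  does not depend on the representative.\<close>
definition rho ::
  "('a::field \<Rightarrow> 'v::ab_group_add \<Rightarrow> 'v) \<Rightarrow> nat \<Rightarrow> 'v th_sys set \<Rightarrow> 'a mat \<times> 'a list \<times> 'a list" where
  "rho scale d C = the_elem (rho_rep scale d ` C)"

definition basis_seq ::
  "('a::field \<Rightarrow> 'v::ab_group_add \<Rightarrow> 'v) \<Rightarrow> nat \<Rightarrow> 'v set \<Rightarrow> (nat \<Rightarrow> 'v) \<Rightarrow> bool" where
  "basis_seq scale d V u \<longleftrightarrow> inj_on u {..d} \<and>
     \<not> module.dependent scale (u ` {..d}) \<and> module.span scale (u ` {..d}) = V"

text \<open>The relation ``\<open>\<Phi>\<close> arises from \<open>(X, \<theta>, \<theta>\<^sup>*)\<close> for some choice of the space and of the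
  two bases''. That \<open>\<Phi>\<close> is a TH system is not part of the definition.\<close>
definition constructed_from ::
  "('a::field \<Rightarrow> 'v::ab_group_add \<Rightarrow> 'v) \<Rightarrow> nat \<Rightarrow> 'a mat \<times> 'a list \<times> 'a list \<Rightarrow> 'v th_sys \<Rightarrow> bool" where
  "constructed_from scale d w \<Phi> \<longleftrightarrow> (case w of (X, \<theta>, \<theta>s) \<Rightarrow>
     let V = th_space \<Phi>; A = th_A \<Phi>; E = th_E \<Phi>; As = th_As \<Phi>; Es = th_Es \<Phi> in
     module.subspace scale V \<and> vector_space.dim scale V = Suc d \<and>
     A \<in> End scale V \<and> As \<in> End scale V \<and>
     (\<exists>u v. basis_seq scale d V u \<and> basis_seq scale d V v \<and>
        (\<forall>j\<le>d. v j = (\<Sum>i\<le>d. scale (X $$ (i, j)) (u i))) \<and>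
        (\<forall>i\<le>d. A (u i) = scale (\<theta> ! i) (u i)) \<and> (\<forall>i\<le>d. As (v i) = scale (\<theta>s ! i) (v i))) \<and>
     length E = Suc d \<and> (\<forall>i\<le>d. primitive_idempotent scale V A (\<theta> ! i) (E ! i)) \<and>
     length Es = Suc d \<and> (\<forall>i\<le>d. primitive_idempotent scale V As (\<theta>s ! i) (Es ! i)))"

definition chi ::
  "('a::field \<Rightarrow> 'v::ab_group_add \<Rightarrow> 'v) \<Rightarrow> nat \<Rightarrow> 'a mat \<times> 'a list \<times> 'a list \<Rightarrow> 'v th_sys set" where
  "chi scale d w = the_elem (TH_class scale d ` {\<Phi>. constructed_from scale d w \<Phi>})"

end

theory Submission
  imports Defs
begin

text \<open>Let \<open>u\<^sub>i\<close> and \<open>v\<^sub>i\<close> be eigenvectors of \<open>A\<close> and \<open>A\<^sup>*\<close> in the given orderings. The TH conditions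
  say that \<open>A v\<^sub>j\<close> lies in the span of \<open>v\<^sub>0, \<dots>, v\<^bsub>j+1\<^esub>\<close> with nonzero \<open>v\<^bsub>j+1\<^esub>\<close>-component, and that
  \<open>A\<^sup>* u\<^sub>j\<close> behaves in the same way with respect to the \<open>u\<^sub>i\<close>. A TH system is therefore known, up to
  isomorphism, from its eigenvalues and from the relative position of the two eigenbases, that is,
  from the matrix \<open>X\<close> with \<open>v\<^sub>j = \<Sum>\<^sub>i X\<^bsub>ij\<^esub> u\<^sub>i\<close>. The vectors can be rescaled such that column \<open>0\<close> and row \<open>d\<close>
  of \<open>X\<close> consist of ones. This leaves only one common scalar free, so the normalized matrix is an
  invariant (\<open>constructed_from_unique\<close>). It remains to compute this matrix and to see which
  matrices occur.

  \<^emph>\<open>From a TH system to its matrix.\<close> The vectors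
  \<open>w\<^sub>h = (A - \<theta>\<^bsub>d-h+1\<^esub>) \<cdots> (A - \<theta>\<^sub>d) v\<^sub>0\<close> form a basis that is triangular with respect to both eigenbases,
  for the \<open>v\<^sub>i\<close> in increasing and for the \<open>u\<^sub>i\<close> in decreasing order. Hence \<open>w\<^sub>h\<close> spans the split space
  \<open>U\<^sub>h\<close>, and \<open>A\<^sup>* w\<^sub>h = \<theta>\<^sup>*\<^sub>h w\<^sub>h + \<phi>\<^sub>h w\<^bsub>h-1\<^esub>\<close> with \<open>\<phi>\<^sub>h \<noteq> 0\<close>. In this basis the eigenvector of
  \<open>A\<^sup>*\<close> for \<open>\<theta>\<^sup>*\<^sub>j\<close> is found by solving a two-term recurrence, while \<open>E\<^sub>i w\<^sub>h\<close> is the multiple of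
  \<open>E\<^sub>i w\<^sub>0\<close> by \<open>(\<theta>\<^sub>i - \<theta>\<^sub>d) \<cdots> (\<theta>\<^sub>i - \<theta>\<^bsub>d-h+1\<^esub>)\<close>. Together these give the entries of the transition
  matrix (\<open>dual_vec_transition\<close>). They are Newton expansions in \<open>\<theta>\<^sub>i\<close> and in \<open>\<theta>\<^sup>*\<^sub>j\<close>, from which the two
  graded sequences can be read off (\<open>newton_matrix_vandermonde\<close>).

  \<^emph>\<open>From a Vandermonde system to a TH system.\<close> If \<open>X\<^bsub>ij\<^esub> = f\<^sub>j(\<theta>\<^sub>i)\<close>, then \<open>A v\<^sub>j = \<Sum>\<^sub>i c\<^sub>i v\<^sub>i\<close> means that
  \<open>\<Sum>\<^sub>i c\<^sub>i f\<^sub>i\<close> and \<open>x f\<^sub>j\<close> agree at the \<open>d + 1\<close> points \<open>\<theta>\<^sub>k\<close>. For \<open>j < d\<close> they are then equal as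
  polynomials, and comparing degrees gives the TH conditions for \<open>A\<close>
  (\<open>graded_recurrence\<close>). The other graded sequence gives those for \<open>A\<^sup>*\<close>.

  \<^emph>\<open>Isomorphisms.\<close> Every algebra isomorphism between endomorphism algebras is conjugation by a linear
  bijection (\<open>algebra_iso_conjugation\<close>), which carries eigenbases to eigenbases without changing
  \<open>X\<close>. Conversely, equal matrices and eigenvalues yield such a bijection. So two TH systems are
  isomorphic if and only if \<open>rho_rep\<close> takes the same value on them (\<open>TH_iso_iff\<close>), and the
  bijectivity of both maps is a formal consequence.\<close>

section \<open>Linear maps and bases of a subspace\<close>

text \<open>In contrast to \<open>End\<close>, source and target may differ and no value is prescribed outside \<open>V\<close>.
  Composites and the identity are then covered without restricting them.\<close>

definition lin_on ::
  "('a::field \<Rightarrow> 'v::ab_group_add \<Rightarrow> 'v) \<Rightarrow> 'v set \<Rightarrow> 'v set \<Rightarrow> ('v \<Rightarrow> 'v) \<Rightarrow> bool" where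
  "lin_on scale V W f \<longleftrightarrow> f \<in> V \<rightarrow> W \<and> (\<forall>x\<in>V. \<forall>y\<in>V. f (x + y) = f x + f y) \<and>
     (\<forall>c. \<forall>x\<in>V. f (scale c x) = scale c (f x))"

lemma End_iff: "f \<in> End scale V \<longleftrightarrow> lin_on scale V V f \<and> f \<in> extensional V"
  by (auto simp: End_def lin_on_def PiE_def)

context vector_space
begin

lemma lin_on_in: "lin_on scale V W f \<Longrightarrow> x \<in> V \<Longrightarrow> f x \<in> W"
  by (auto simp: lin_on_def)

lemma lin_on_scale: "lin_on scale V W f \<Longrightarrow> x \<in> V \<Longrightarrow> f (c *s x) = c *s f x"
  by (auto simp: lin_on_def)

lemma lin_on_add: "lin_on scale V W f \<Longrightarrow> x \<in> V \<Longrightarrow> y \<in> V \<Longrightarrow> f (x + y) = f x + f y"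
  by (auto simp: lin_on_def)

lemma lin_on_0: "lin_on scale V W f \<Longrightarrow> subspace V \<Longrightarrow> f 0 = 0"
  using lin_on_scale[of V W f 0 0] subspace_0 by simp

lemma lin_on_diff:
  assumes "lin_on scale V W f" "subspace V" "x \<in> V" "y \<in> V"
  shows "f (x - y) = f x - f y"
proof -
  have "f (x - y) + f y = f x"
    using lin_on_add[OF assms(1) subspace_diff[OF assms(2-4)] assms(4)] by simp
  then show ?thesis by (simp add: algebra_simps)
qed

lemma lin_on_sum:
  assumes f: "lin_on scale V W f" and V: "subspace V" and "\<And>i. i \<in> I \<Longrightarrow> x i \<in> V"
  shows "f (\<Sum>i\<in>I. x i) = (\<Sum>i\<in>I. f (x i))"
  using assms(3)
proof (induction I rule: infinite_finite_induct)
  case (insert i I)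
  then show ?case
    using lin_on_add[OF f, of "x i" "\<Sum>i\<in>I. x i"] subspace_sum[OF V, of I x] by simp
qed (auto simp: lin_on_0[OF f V])

lemma lin_on_comb:
  assumes f: "lin_on scale V W f" and V: "subspace V" and x: "\<And>i. i \<in> I \<Longrightarrow> x i \<in> V"
  shows "f (\<Sum>i\<in>I. c i *s x i) = (\<Sum>i\<in>I. c i *s f (x i))"
  using lin_on_sum[OF f V, of I "\<lambda>i. c i *s x i"] subspace_scale[OF V x] lin_on_scale[OF f x]
  by simp

lemma EndD:
  assumes "f \<in> End scale V"
  shows "lin_on scale V V f" "x \<in> V \<Longrightarrow> f x \<in> V" "x \<in> V \<Longrightarrow> f (c *s x) = c *s f x"
    "x \<in> V \<Longrightarrow> y \<in> V \<Longrightarrow> f (x + y) = f x + f y" "f \<in> extensional V"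
  using assms by (auto simp: End_iff lin_on_in lin_on_scale lin_on_add)

lemma compose_End:
  assumes V: "subspace V" and f: "f \<in> End scale V" and g: "g \<in> End scale V"
  shows "compose V f g \<in> End scale V"
  using EndD[OF f] EndD[OF g] subspace_scale[OF V] subspace_add[OF V]
  unfolding End_iff lin_on_def compose_def by auto

text \<open>Coefficients are attached to indices instead of vectors. A vector that occurs twice gives a
  nontrivial relation between indices, which is why injectivity appears on the left.\<close>

lemma inj_on_independent_iff:
  fixes d :: nat
  shows "inj_on u {..d} \<and> independent (u ` {..d}) \<longleftrightarrow>
    (\<forall>c. (\<Sum>i\<le>d. c i *s u i) = 0 \<longrightarrow> (\<forall>i\<le>d. c i = 0))"
proof (intro iffI allI impI)
  fix c i
  assume u: "inj_on u {..d} \<and> independent (u ` {..d})" and c: "(\<Sum>i\<le>d. c i *s u i) = 0"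
    and i: "i \<le> d"
  let ?b = "\<lambda>x. c (inv_into {..d} u x)"
  have "(\<Sum>x\<in>u ` {..d}. ?b x *s x) = 0"
    using u c by (subst sum.reindex) (auto simp: inv_into_f_f)
  then have "?b (u i) = 0"
    using u i independentD[of "u ` {..d}" "u ` {..d}" ?b "u i"] by auto
  then show "c i = 0" using u i by (simp add: inv_into_f_f)
next
  assume *: "\<forall>c. (\<Sum>i\<le>d. c i *s u i) = 0 \<longrightarrow> (\<forall>i\<le>d. c i = 0)"
  have inj: "inj_on u {..d}"
  proof (rule inj_onI, rule ccontr)
    fix i j assume ij: "i \<in> {..d}" "j \<in> {..d}" "u i = u j" "i \<noteq> j"
    define c where "c k = (if k = i then 1 else if k = j then - 1 else 0 :: 'a)" for k
    have "(\<Sum>k\<le>d. c k *s u k) = (\<Sum>k\<in>{i, j}. c k *s u k)"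
      using ij by (intro sum.mono_neutral_right) (auto simp: c_def)
    also have "\<dots> = 0" using ij by (auto simp: c_def)
    finally have "c i = 0" using * ij(1) by auto
    then show False by (simp add: c_def)
  qed
  moreover have "independent (u ` {..d})"
  proof (rule independent_if_scalars_zero)
    fix f x assume "(\<Sum>x\<in>u ` {..d}. f x *s x) = 0" "x \<in> u ` {..d}"
    then show "f x = 0" using *[rule_format, of "f \<circ> u"] inj by (auto simp: sum.reindex)
  qed simp
  ultimately show "inj_on u {..d} \<and> independent (u ` {..d})" by simp
qed

lemma basis_seq_subspace: "basis_seq scale d V u \<Longrightarrow> subspace V"
  by (auto simp: basis_seq_def)

lemma basis_seq_in: "basis_seq scale d V u \<Longrightarrow> i \<le> d \<Longrightarrow> u i \<in> V"
  using span_base[of "u i" "u ` {..d}"] by (auto simp: basis_seq_def)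

lemma basis_seq_dim: "basis_seq scale d V u \<Longrightarrow> dim V = Suc d"
  using dim_span_eq_card_independent[of "u ` {..d}"] by (auto simp: basis_seq_def card_image)

lemma basis_seq_eq_0:
  "basis_seq scale d V u \<Longrightarrow> (\<Sum>i\<le>d. c i *s u i) = 0 \<Longrightarrow> i \<le> d \<Longrightarrow> c i = 0"
  using inj_on_independent_iff[of u d] by (auto simp: basis_seq_def)

lemma basis_seq_eqD:
  assumes "basis_seq scale d V u" "(\<Sum>i\<le>d. c i *s u i) = (\<Sum>i\<le>d. c' i *s u i)" "i \<le> d"
  shows "c i = c' i"
  using basis_seq_eq_0[OF assms(1), of "\<lambda>i. c i - c' i", OF _ assms(3)] assms(2)
  by (simp add: scale_left_diff_distrib sum_subtractf)

lemma basis_seq_nonzero: "basis_seq scale d V u \<Longrightarrow> i \<le> d \<Longrightarrow> u i \<noteq> 0"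
  using dependent_zero[of "u ` {..d}"] by (force simp: basis_seq_def)

lemma basis_seq_expand:
  assumes "basis_seq scale d V u" "x \<in> V"
  shows "\<exists>c. x = (\<Sum>i\<le>d. c i *s u i)"
proof -
  have "x \<in> span (u ` {..d})" using assms by (auto simp: basis_seq_def)
  then obtain f where "x = (\<Sum>y\<in>u ` {..d}. f y *s y)"
    by (auto simp: span_finite)
  then have "x = (\<Sum>i\<le>d. (f \<circ> u) i *s u i)"
    using assms(1) by (simp add: basis_seq_def sum.reindex)
  then show ?thesis by blast
qed

lemma basis_seq_comb_in: "basis_seq scale d V u \<Longrightarrow> (\<Sum>i\<le>d. c i *s u i) \<in> V"
  by (intro subspace_sum subspace_scale basis_seq_in) (auto dest: basis_seq_subspace)

lemma subspace_has_basis_seq: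
  assumes V: "subspace V" "dim V = Suc d"
  shows "\<exists>u. basis_seq scale d V u"
proof -
  obtain B where B: "B \<subseteq> V" "independent B" "V \<subseteq> span B" "card B = Suc d"
    using basis_exists[of V] V(2) by metis
  then obtain u where "bij_betw u {0..<Suc d} B"
    using ex_bij_betw_nat_finite[of B] by (metis card.infinite nat.distinct(1))
  then have "bij_betw u {..d} B" by (simp add: atLeast0LessThan lessThan_Suc_atMost)
  then have "basis_seq scale d V u"
    using B span_subspace[OF B(1,3) V(1)] by (auto simp: basis_seq_def bij_betw_def)
  then show ?thesis by blast
qed

text \<open>A vector of \<open>V\<close> outside the span would give \<open>d + 2\<close> independent vectors in a space spanned by
  \<open>d + 1\<close> vectors.\<close>

lemma independent_basis_seq:
  assumes V: "subspace V" "dim V = Suc d" and u: "\<And>i. i \<le> d \<Longrightarrow> u i \<in> V"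
    and ind: "\<And>c i. (\<Sum>i\<le>d. c i *s u i) = 0 \<Longrightarrow> i \<le> d \<Longrightarrow> c i = 0"
  shows "basis_seq scale d V u"
proof -
  have "inj_on u {..d} \<and> independent (u ` {..d})"
    unfolding inj_on_independent_iff using ind by simp
  then have iu: "inj_on u {..d}" "independent (u ` {..d})" by simp_all
  obtain b where b: "basis_seq scale d V b" using subspace_has_basis_seq[OF V] ..
  have "x \<in> span (u ` {..d})" if "x \<in> V" for x
  proof (rule ccontr)
    assume x: "x \<notin> span (u ` {..d})"
    then have "independent (insert x (u ` {..d}))" using iu by (intro independent_insertI)
    moreover have "insert x (u ` {..d}) \<subseteq> span (b ` {..d})"
      using that u b by (auto simp: basis_seq_def)
    ultimately have "card (insert x (u ` {..d})) \<le> card (b ` {..d})"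
      using independent_span_bound[of "b ` {..d}"] by blast
    moreover have "x \<notin> u ` {..d}" using x span_base[of x] by metis
    ultimately show False using iu b by (simp add: card_image basis_seq_def)
  qed
  then have "span (u ` {..d}) = V"
    using u by (intro span_subspace) (auto simp: V)
  then show ?thesis using iu by (simp add: basis_seq_def)
qed

lemma lin_on_eqI:
  assumes b: "basis_seq scale d V u" and f: "lin_on scale V W f" and g: "lin_on scale V W' g"
    and eq: "\<And>i. i \<le> d \<Longrightarrow> f (u i) = g (u i)" and x: "x \<in> V"
  shows "f x = g x"
proof -
  obtain c where c: "x = (\<Sum>i\<le>d. c i *s u i)" using basis_seq_expand[OF b x] ..
  show ?thesis unfolding c
    using lin_on_comb[OF f basis_seq_subspace[OF b], of "{..d}" u c]
      lin_on_comb[OF g basis_seq_subspace[OF b], of "{..d}" u c] basis_seq_in[OF b] eq by simp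
qed

lemma End_eqI:
  assumes b: "basis_seq scale d V u" and f: "f \<in> End scale V" and g: "g \<in> End scale V"
    and "\<And>i. i \<le> d \<Longrightarrow> f (u i) = g (u i)"
  shows "f = g"
  using lin_on_eqI[OF b EndD(1)[OF f] EndD(1)[OF g] assms(4)] EndD(5)[OF f] EndD(5)[OF g]
  by (intro extensionalityI) auto

text \<open>The image of a vector is computed from its coordinates. Linearity holds since coordinates are
  unique.\<close>

lemma lin_extend:
  assumes b: "basis_seq scale d V u" and W: "subspace W" and y: "\<forall>i\<le>d. y i \<in> W"
  shows "\<exists>f. lin_on scale V W f \<and> f \<in> extensional V \<and> (\<forall>i\<le>d. f (u i) = y i)"
proof -
  obtain k where k: "\<And>x. x \<in> V \<Longrightarrow> x = (\<Sum>i\<le>d. k x i *s u i)"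
    using basis_seq_expand[OF b] by metis
  have V: "subspace V" by (rule basis_seq_subspace[OF b])
  define f where "f = (\<lambda>x\<in>V. \<Sum>i\<le>d. k x i *s y i)"
  have uniq: "k x i = c i" if "x \<in> V" "x = (\<Sum>i\<le>d. c i *s u i)" "i \<le> d" for x c i
    using basis_seq_eqD[OF b, of "k x" c] k[OF that(1)] that(2,3) by simp
  have "lin_on scale V W f" unfolding lin_on_def
  proof (intro conjI ballI allI funcsetI)
    show "f x \<in> W" if "x \<in> V" for x
      using that y by (auto simp: f_def intro!: subspace_sum[OF W] subspace_scale[OF W])
    fix x y' assume xy: "x \<in> V" "y' \<in> V"
    have "x + y' = (\<Sum>i\<le>d. (k x i + k y' i) *s u i)"
      using k[OF xy(1)] k[OF xy(2)] by (simp add: scale_left_distrib sum.distrib)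
    from uniq[OF subspace_add[OF V xy] this] show "f (x + y') = f x + f y'"
      using xy subspace_add[OF V xy] by (simp add: f_def scale_left_distrib sum.distrib)
  next
    fix c x assume x: "x \<in> V"
    have "c *s x = (\<Sum>i\<le>d. (c * k x i) *s u i)"
      using arg_cong[OF k[OF x], of "scale c"] by (simp add: scale_sum_right)
    from uniq[OF subspace_scale[OF V x] this] show "f (c *s x) = c *s f x"
      using x subspace_scale[OF V x] by (simp add: f_def scale_sum_right)
  qed
  moreover have "f (u i) = y i" if i: "i \<le> d" for i
  proof -
    have "u i = (\<Sum>j\<le>d. (if j = i then 1 else 0) *s u j)"
      using i by (simp add: if_distrib[of "\<lambda>c. c *s _"] cong: if_cong)
    from uniq[OF basis_seq_in[OF b i] this]
    have "f (u i) = (\<Sum>j\<le>d. (if j = i then 1 else 0) *s y j)"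
      using basis_seq_in[OF b i] by (simp add: f_def)
    also have "\<dots> = y i"
      using i by (simp add: if_distrib[of "\<lambda>c. c *s _"] cong: if_cong)
    finally show ?thesis .
  qed
  ultimately show ?thesis by (intro exI[of _ f]) (auto simp: f_def)
qed

lemma End_extend:
  assumes b: "basis_seq scale d V u" and y: "\<forall>i\<le>d. y i \<in> V"
  shows "\<exists>f\<in>End scale V. \<forall>i\<le>d. f (u i) = y i"
  using lin_extend[OF b basis_seq_subspace[OF b] y] by (auto simp: End_iff)

text \<open>Some basis vector occurs in \<open>x\<close> with a nonzero coefficient. The map sends this vector to a
  multiple of \<open>y\<close> and all others to \<open>0\<close>.\<close>

lemma End_transitive:
  assumes b: "basis_seq scale d V u" and x: "x \<in> V" "x \<noteq> 0" and y: "y \<in> V"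
  shows "\<exists>f\<in>End scale V. f x = y"
proof -
  obtain c where c: "x = (\<Sum>i\<le>d. c i *s u i)" using basis_seq_expand[OF b x(1)] ..
  have "\<not> (\<forall>k\<le>d. c k = 0)"
  proof
    assume "\<forall>k\<le>d. c k = 0"
    then have "x = 0" unfolding c by (intro sum.neutral) auto
    then show False using x(2) by simp
  qed
  then obtain k where k: "k \<le> d" "c k \<noteq> 0" by auto
  have "\<forall>i\<le>d. (if i = k then inverse (c k) *s y else 0) \<in> V"
    using subspace_scale[OF basis_seq_subspace[OF b] y] subspace_0[OF basis_seq_subspace[OF b]]
    by auto
  from End_extend[OF b this] obtain f where f: "f \<in> End scale V"
    "\<And>i. i \<le> d \<Longrightarrow> f (u i) = (if i = k then inverse (c k) *s y else 0)" by blast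
  have "f x = (\<Sum>i\<le>d. c i *s f (u i))"
    unfolding c using lin_on_comb[OF EndD(1)[OF f(1)] basis_seq_subspace[OF b], of "{..d}" u c]
      basis_seq_in[OF b] by simp
  also have "\<dots> = (\<Sum>i\<le>d. if i = k then y else 0)"
    using f(2) k by (intro sum.cong) auto
  also have "\<dots> = y" using k by simp
  finally show ?thesis using f(1) by blast
qed

end

section \<open>Multiplicity-free endomorphisms and their primitive idempotents\<close>

text \<open>The eigenvalues are required to be distinct, so that every eigenspace is a line spanned by one
  of the vectors.\<close>

definition eigenbasis ::
  "('a::field \<Rightarrow> 'v::ab_group_add \<Rightarrow> 'v) \<Rightarrow> nat \<Rightarrow> 'v set \<Rightarrow> ('v \<Rightarrow> 'v) \<Rightarrow>
    (nat \<Rightarrow> 'a) \<Rightarrow> (nat \<Rightarrow> 'v) \<Rightarrow> bool" where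
  "eigenbasis scale d V A \<theta> u \<longleftrightarrow> basis_seq scale d V u \<and> A \<in> End scale V \<and>
     inj_on \<theta> {..d} \<and> (\<forall>i\<le>d. A (u i) = scale (\<theta> i) (u i))"

text \<open>The vectors are arbitrary eigenvectors; the two bases are not normalized with respect to each
  other.\<close>

definition eigenframe ::
  "('a::field \<Rightarrow> 'v::ab_group_add \<Rightarrow> 'v) \<Rightarrow> nat \<Rightarrow> 'v th_sys \<Rightarrow>
    (nat \<Rightarrow> 'a) \<Rightarrow> (nat \<Rightarrow> 'v) \<Rightarrow> (nat \<Rightarrow> 'a) \<Rightarrow> (nat \<Rightarrow> 'v) \<Rightarrow> bool" where
  "eigenframe scale d \<Phi> \<theta> u \<theta>s v \<longleftrightarrow>
     eigenbasis scale d (th_space \<Phi>) (th_A \<Phi>) \<theta> u \<and>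
     eigenbasis scale d (th_space \<Phi>) (th_As \<Phi>) \<theta>s v \<and>
     length (th_E \<Phi>) = Suc d \<and> length (th_Es \<Phi>) = Suc d \<and>
     (\<forall>i\<le>d. primitive_idempotent scale (th_space \<Phi>) (th_A \<Phi>) (\<theta> i) (th_E \<Phi> ! i) \<and>
       primitive_idempotent scale (th_space \<Phi>) (th_As \<Phi>) (\<theta>s i) (th_Es \<Phi> ! i))"

context vector_space
begin

lemma eigenbasisD:
  assumes "eigenbasis scale d V A \<theta> u"
  shows "basis_seq scale d V u" "subspace V" "dim V = Suc d" "A \<in> End scale V" "inj_on \<theta> {..d}"
    "i \<le> d \<Longrightarrow> u i \<in> V" "i \<le> d \<Longrightarrow> u i \<noteq> 0" "i \<le> d \<Longrightarrow> A (u i) = \<theta> i *s u i"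
  using assms basis_seq_subspace basis_seq_in basis_seq_nonzero basis_seq_dim
  unfolding eigenbasis_def by blast+

lemma eigenvector_coeff:
  assumes e: "eigenbasis scale d V A \<theta> u" and i: "i \<le> d"
    and x: "A (\<Sum>i\<le>d. k i *s u i) = c *s (\<Sum>i\<le>d. k i *s u i)"
  shows "k i = 0 \<or> \<theta> i = c"
proof -
  note D = eigenbasisD[OF e]
  have "(\<Sum>i\<le>d. (k i * \<theta> i) *s u i) = (\<Sum>i\<le>d. (c * k i) *s u i)"
    using x lin_on_comb[OF EndD(1)[OF D(4)] D(2), of "{..d}" u k] D(6,8)
    by (simp add: scale_sum_right)
  from basis_seq_eqD[OF D(1) this i] show ?thesis by (simp add: mult.commute)
qed

lemma eigenspace_eigenbasis:
  assumes e: "eigenbasis scale d V A \<theta> u" and i: "i \<le> d"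
  shows "eigenspace scale V A (\<theta> i) = range (\<lambda>c. c *s u i)"
proof (intro equalityI subsetI)
  note D = eigenbasisD[OF e]
  fix x assume "x \<in> eigenspace scale V A (\<theta> i)"
  then have x: "x \<in> V" "A x = \<theta> i *s x" by (auto simp: eigenspace_def)
  obtain k where k: "x = (\<Sum>i\<le>d. k i *s u i)" using basis_seq_expand[OF D(1) x(1)] ..
  have "k j = 0" if "j \<le> d" "j \<noteq> i" for j
    using eigenvector_coeff[OF e that(1), of k "\<theta> i"] x(2) inj_onD[OF D(5), of j i] that i
    unfolding k by auto
  then have "x = (\<Sum>j\<le>d. if j = i then k i *s u i else 0)"
    unfolding k by (intro sum.cong) auto
  then have "x = k i *s u i" using i by simp
  then show "x \<in> range (\<lambda>c. c *s u i)" by blast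
next
  note D = eigenbasisD[OF e]
  fix x assume "x \<in> range (\<lambda>c. c *s u i)"
  then show "x \<in> eigenspace scale V A (\<theta> i)"
    using subspace_scale[OF D(2) D(6)[OF i]] EndD(3)[OF D(4) D(6)[OF i]] D(8)[OF i]
    by (auto simp: eigenspace_def mult.commute)
qed

lemma eigenspace_trivial:
  assumes e: "eigenbasis scale d V A \<theta> u" and c: "c \<notin> \<theta> ` {..d}"
  shows "eigenspace scale V A c = {0}"
proof (intro equalityI subsetI)
  note D = eigenbasisD[OF e]
  fix x assume "x \<in> eigenspace scale V A c"
  then have x: "x \<in> V" "A x = c *s x" by (auto simp: eigenspace_def)
  obtain k where k: "x = (\<Sum>i\<le>d. k i *s u i)" using basis_seq_expand[OF D(1) x(1)] ..
  have "k j = 0" if "j \<le> d" for j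
    using eigenvector_coeff[OF e that, of k c] x(2) c that unfolding k by auto
  then show "x \<in> {0}" unfolding k by simp
next
  note D = eigenbasisD[OF e]
  fix x :: 'b assume "x \<in> {0}"
  then show "x \<in> eigenspace scale V A c"
    using subspace_0[OF D(2)] lin_on_0[OF EndD(1)[OF D(4)] D(2)] by (simp add: eigenspace_def)
qed

lemma eigenspace_cases:
  assumes e: "eigenbasis scale d V A \<theta> u" and x: "x \<in> eigenspace scale V A c"
  shows "x = 0 \<or> (\<exists>i\<le>d. \<exists>k. c = \<theta> i \<and> x = k *s u i)"
proof (cases "c \<in> \<theta> ` {..d}")
  case True
  then obtain i where "i \<le> d" "c = \<theta> i" by auto
  then show ?thesis using eigenspace_eigenbasis[OF e, of i] x by auto
qed (use eigenspace_trivial[OF e] x in auto)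

lemma is_eigenvalue_iff:
  assumes e: "eigenbasis scale d V A \<theta> u"
  shows "is_eigenvalue scale V A c \<longleftrightarrow> c \<in> \<theta> ` {..d}"
proof
  show "is_eigenvalue scale V A c \<Longrightarrow> c \<in> \<theta> ` {..d}"
    using eigenspace_trivial[OF e] by (auto simp: is_eigenvalue_def)
  assume "c \<in> \<theta> ` {..d}"
  then obtain i where i: "i \<le> d" "c = \<theta> i" by auto
  have "1 *s u i \<in> eigenspace scale V A c"
    unfolding i(2) eigenspace_eigenbasis[OF e i(1)] by (rule rangeI)
  then show "is_eigenvalue scale V A c"
    using eigenbasisD(7)[OF e i(1)] by (auto simp: is_eigenvalue_def)
qed

lemma multiplicity_free_eigenbasis:
  assumes e: "eigenbasis scale d V A \<theta> u"
  shows "multiplicity_free scale V A"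
  unfolding multiplicity_free_def diagonalizable_def
proof (intro conjI allI impI)
  note D = eigenbasisD[OF e]
  show "A \<in> End scale V" by (rule D(4))
  show "\<exists>B. independent B \<and> span B = V \<and> (\<forall>b\<in>B. \<exists>c. A b = c *s b)"
    using e by (intro exI[of _ "u ` {..d}"]) (auto simp: eigenbasis_def basis_seq_def)
  fix c assume "is_eigenvalue scale V A c"
  then obtain i where i: "i \<le> d" "c = \<theta> i" by (auto simp: is_eigenvalue_iff[OF e])
  then have "eigenspace scale V A c = span {u i}"
    by (simp add: eigenspace_eigenbasis[OF e] span_singleton)
  then show "dim (eigenspace scale V A c) = 1"
    using D(7)[OF i(1)] dim_span_eq_card_independent[of "{u i}"] by simp
qed

text \<open>In an eigenbasis the primitive idempotent is the coordinate projection to one of the lines.\<close>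

lemma primitive_idempotent_iff:
  assumes e: "eigenbasis scale d V A \<theta> u" and i: "i \<le> d"
  shows "primitive_idempotent scale V A (\<theta> i) P \<longleftrightarrow>
    P \<in> End scale V \<and> (\<forall>j\<le>d. P (u j) = (if j = i then u j else 0))"
proof (intro iffI conjI allI impI)
  note D = eigenbasisD[OF e]
  have inj: "\<theta> j \<noteq> \<theta> i" if "j \<le> d" "j \<noteq> i" for j
    using inj_onD[OF D(5), of j i] that i by auto
  have es: "u j \<in> eigenspace scale V A (\<theta> j)" if "j \<le> d" for j
    using D(6,8) that by (auto simp: eigenspace_def)
  show "P \<in> End scale V" if "primitive_idempotent scale V A (\<theta> i) P"
    using that by (simp add: primitive_idempotent_def)
  show "P (u j) = (if j = i then u j else 0)"
    if "primitive_idempotent scale V A (\<theta> i) P" "j \<le> d" for j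
    using that es[of j] inj[of j] by (auto simp: primitive_idempotent_def)
  assume P: "P \<in> End scale V \<and> (\<forall>j\<le>d. P (u j) = (if j = i then u j else 0))"
  have P0: "P 0 = 0" using P lin_on_0[OF EndD(1) D(2)] by blast
  have "P x = x" if "x \<in> eigenspace scale V A (\<theta> i)" for x
    using that P i EndD(3)[of P V "u i"] D(6)[OF i] by (auto simp: eigenspace_eigenbasis[OF e i])
  moreover have "P x = 0" if "c' \<noteq> \<theta> i" "x \<in> eigenspace scale V A c'" for c' x
    using eigenspace_cases[OF e that(2)]
  proof
    assume "\<exists>j\<le>d. \<exists>k. c' = \<theta> j \<and> x = k *s u j"
    then obtain j k where "j \<le> d" "c' = \<theta> j" "x = k *s u j" by blast
    then show ?thesis using P that(1) EndD(3)[of P V "u j"] D(6)[of j] by (cases "j = i") auto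
  qed (simp add: P0)
  ultimately show "primitive_idempotent scale V A (\<theta> i) P"
    using P i by (auto simp: primitive_idempotent_def is_eigenvalue_iff[OF e])
qed

lemma primitive_idempotent_exists:
  assumes e: "eigenbasis scale d V A \<theta> u" and i: "i \<le> d"
  shows "\<exists>P. primitive_idempotent scale V A (\<theta> i) P"
proof -
  have "\<forall>j\<le>d. (if j = i then u j else 0) \<in> V"
    using eigenbasisD(6)[OF e] subspace_0[OF eigenbasisD(2)[OF e]] by auto
  from End_extend[OF eigenbasisD(1)[OF e] this] show ?thesis
    unfolding primitive_idempotent_iff[OF e i] by blast
qed

text \<open>A diagonalizable map has a spanning set of eigenvectors, and on each of them the eigenvalue
  \<open>c\<close> prescribes the value of the idempotent.\<close>

lemma primitive_idempotent_unique:
  assumes "multiplicity_free scale V A" "subspace V"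
    and P: "primitive_idempotent scale V A c P" and Q: "primitive_idempotent scale V A c Q"
  shows "P = Q"
proof -
  obtain B where B: "span B = V" "\<And>b. b \<in> B \<Longrightarrow> \<exists>c. A b = c *s b"
    using assms(1) by (auto simp: multiplicity_free_def diagonalizable_def)
  have PQ: "P \<in> End scale V" "Q \<in> End scale V"
    using P Q by (auto simp: primitive_idempotent_def)
  have PQ0: "P 0 = 0" "Q 0 = 0"
    using PQ lin_on_0[OF EndD(1) assms(2)] by blast+
  \<comment> \<open>Two linear maps agree on a subspace, which here contains a spanning set.\<close>
  have "subspace {x \<in> V. P x = Q x}"
    using subspace_add[OF assms(2)] subspace_scale[OF assms(2)] subspace_0[OF assms(2)] PQ PQ0
    by (intro subspaceI) (auto simp: EndD(3,4))
  moreover have "P b = Q b \<and> b \<in> V" if b: "b \<in> B" for b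
  proof -
    obtain k where "A b = k *s b" using B(2)[OF b] ..
    moreover have "b \<in> V" using B(1) span_base[OF b] by auto
    ultimately have "b \<in> eigenspace scale V A k" "b \<in> V" by (auto simp: eigenspace_def)
    then show ?thesis using P Q by (cases "k = c") (auto simp: primitive_idempotent_def)
  qed
  ultimately have "span B \<subseteq> {x \<in> V. P x = Q x}" by (intro span_minimal) auto
  then show ?thesis
    using B(1) EndD(5)[OF PQ(1)] EndD(5)[OF PQ(2)] by (intro extensionalityI[of _ V]) auto
qed

text \<open>Applying \<open>P i\<close> to a linear relation isolates its term with index \<open>i\<close>.\<close>

lemma biorthogonal_basis_seq:
  assumes V: "subspace V" "dim V = Suc d"
    and u: "\<And>i. i \<le> d \<Longrightarrow> u i \<in> V" "\<And>i. i \<le> d \<Longrightarrow> u i \<noteq> 0"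
    and P: "\<And>i. i \<le> d \<Longrightarrow> P i \<in> End scale V"
      "\<And>i j. i \<le> d \<Longrightarrow> j \<le> d \<Longrightarrow> P i (u j) = (if j = i then u j else 0)"
  shows "basis_seq scale d V u"
proof (rule independent_basis_seq[OF V u(1)])
  fix c i assume c: "(\<Sum>j\<le>d. c j *s u j) = 0" and i: "i \<le> d"
  have "0 = P i (\<Sum>j\<le>d. c j *s u j)"
    unfolding c using lin_on_0[OF EndD(1)[OF P(1)[OF i]] V(1)] by simp
  also have "\<dots> = (\<Sum>j\<le>d. c j *s P i (u j))"
    using lin_on_comb[OF EndD(1)[OF P(1)[OF i]] V(1), of "{..d}" u c] u(1) by simp
  also have "\<dots> = (\<Sum>j\<le>d. if j = i then c i *s u i else 0)"
    using P(2)[OF i] by (intro sum.cong) auto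
  also have "\<dots> = c i *s u i" using i by simp
  finally show "c i = 0" using u(2)[OF i] by simp
qed simp

text \<open>An eigenvalue determines its idempotent, so the distinctness of the idempotents in the ordering
  makes the chosen eigenvalues distinct.\<close>

lemma eigenbasis_exists:
  assumes V: "subspace V" "dim V = Suc d" and mf: "multiplicity_free scale V A"
    and E: "length E = Suc d" "idempotent_ordering scale V A E"
  obtains \<theta> u where "eigenbasis scale d V A \<theta> u"
    "\<And>i. i \<le> d \<Longrightarrow> primitive_idempotent scale V A (\<theta> i) (E ! i)"
proof -
  have "\<forall>i\<in>{..d}. \<exists>c. primitive_idempotent scale V A c (E ! i)"
    using E nth_mem[of _ E] by (auto simp: idempotent_ordering_def)
  then obtain \<theta> where \<theta>: "\<And>i. i \<le> d \<Longrightarrow> primitive_idempotent scale V A (\<theta> i) (E ! i)"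
    by (metis atMost_iff)
  have inj: "inj_on \<theta> {..d}"
  proof (rule inj_onI)
    fix i j assume ij: "i \<in> {..d}" "j \<in> {..d}" "\<theta> i = \<theta> j"
    then have "E ! i = E ! j"
      using primitive_idempotent_unique[OF mf V(1) \<theta>[of i]] \<theta>[of j] by simp
    then show "i = j"
      using E ij by (auto simp: idempotent_ordering_def nth_eq_iff_index_eq)
  qed
  have A: "A \<in> End scale V" using mf by (simp add: multiplicity_free_def)
  have "\<exists>x\<in>eigenspace scale V A (\<theta> i). x \<noteq> 0" if "i \<le> d" for i
  proof (rule ccontr)
    assume "\<not> ?thesis"
    moreover have "0 \<in> eigenspace scale V A (\<theta> i)"
      using subspace_0[OF V(1)] lin_on_0[OF EndD(1)[OF A] V(1)] by (simp add: eigenspace_def)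
    ultimately show False
      using \<theta>[OF that] by (auto simp: primitive_idempotent_def is_eigenvalue_def)
  qed
  then obtain u where u: "\<And>i. i \<le> d \<Longrightarrow> u i \<in> eigenspace scale V A (\<theta> i)"
    "\<And>i. i \<le> d \<Longrightarrow> u i \<noteq> 0"
    by metis
  have "basis_seq scale d V u"
  proof (rule biorthogonal_basis_seq[OF V _ u(2), where P = "\<lambda>i. E ! i"])
    show "u i \<in> V" if "i \<le> d" for i using u(1)[OF that] by (simp add: eigenspace_def)
    show "E ! i \<in> End scale V" if "i \<le> d" for i
      using \<theta>[OF that] by (simp add: primitive_idempotent_def)
    show "(E ! i) (u j) = (if j = i then u j else 0)" if "i \<le> d" "j \<le> d" for i j
      using \<theta>[OF that(1)] u(1)[OF that(2)] inj_onD[OF inj, of j i] that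
      by (cases "j = i") (auto simp: primitive_idempotent_def)
  qed
  then have "eigenbasis scale d V A \<theta> u"
    using inj A u(1) by (auto simp: eigenbasis_def eigenspace_def)
  then show ?thesis using \<theta> that by blast
qed

lemma idempotent_ordering_eigenbasis:
  assumes e: "eigenbasis scale d V A \<theta> u" and "length E = Suc d"
    and E: "\<And>i. i \<le> d \<Longrightarrow> primitive_idempotent scale V A (\<theta> i) (E ! i)"
  shows "idempotent_ordering scale V A E"
proof -
  note D = eigenbasisD[OF e]
  have E': "(E ! i) (u j) = (if j = i then u j else 0)" if "i \<le> d" "j \<le> d" for i j
    using E[OF that(1)] that(2) by (simp add: primitive_idempotent_iff[OF e that(1)])
  have "distinct E"
    unfolding distinct_conv_nth
  proof (intro allI impI)
    fix i j assume ij: "i < length E" "j < length E" "i \<noteq> j"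
    then have "(E ! i) (u i) \<noteq> (E ! j) (u i)"
      using E'[of i i] E'[of j i] D(7)[of i] assms(2) by auto
    then show "E ! i \<noteq> E ! j" by auto
  qed
  moreover have "P \<in> set E" if P: "primitive_idempotent scale V A c P" for c P
  proof -
    obtain i where i: "i \<le> d" "c = \<theta> i"
      using P is_eigenvalue_iff[OF e] by (auto simp: primitive_idempotent_def)
    then have "P = E ! i"
      using primitive_idempotent_unique[OF multiplicity_free_eigenbasis[OF e] D(2) P] E by simp
    then show ?thesis using i(1) assms(2) by simp
  qed
  moreover have "\<exists>c. primitive_idempotent scale V A c P" if "P \<in> set E" for P
    using that E assms(2) by (auto simp: in_set_conv_nth less_Suc_eq_le)
  ultimately show ?thesis by (auto simp: idempotent_ordering_def)
qed

text \<open>The image of \<open>Q\<close> is the line through \<open>u i\<close>, so a product ending in \<open>Q\<close> is decided by its value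
  on this one vector.\<close>

lemma compose_eq_0_iff:
  assumes e: "eigenbasis scale d V A \<theta> u" and i: "i \<le> d" and P: "P \<in> End scale V"
    and B: "B \<in> End scale V" and Q: "primitive_idempotent scale V A (\<theta> i) Q"
  shows "compose V P (compose V B Q) = (\<lambda>x\<in>V. 0) \<longleftrightarrow> P (B (u i)) = 0"
proof -
  note D = eigenbasisD[OF e]
  have Q': "Q \<in> End scale V" "\<And>j. j \<le> d \<Longrightarrow> Q (u j) = (if j = i then u j else 0)"
    using Q by (auto simp: primitive_idempotent_iff[OF e i])
  let ?R = "compose V P (compose V B Q)"
  have R: "?R (u j) = (if j = i then P (B (u i)) else 0)" if "j \<le> d" for j
    using D(6)[OF that] Q'(2)[OF that] lin_on_0[OF EndD(1)[OF P] D(2)]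
      lin_on_0[OF EndD(1)[OF B] D(2)] by (simp add: compose_def)
  have "?R \<in> End scale V" using P B Q'(1) by (intro compose_End D)
  moreover have "(\<lambda>x\<in>V. 0) \<in> End scale V"
    using subspace_0[OF D(2)] subspace_add[OF D(2)] subspace_scale[OF D(2)]
    by (auto simp: End_iff lin_on_def)
  ultimately have "?R = (\<lambda>x\<in>V. 0) \<longleftrightarrow> (\<forall>j\<le>d. ?R (u j) = 0)"
    using End_eqI[OF D(1), of ?R "\<lambda>x\<in>V. 0"] D(6) by (metis restrict_apply')
  also have "\<dots> \<longleftrightarrow> P (B (u i)) = 0" using R i by auto
  finally show ?thesis .
qed

lemma eigenframe_eig:
  assumes f: "eigenframe scale d \<Phi> \<theta> u \<theta>s v" and i: "i \<le> d"
  shows "eig scale \<Phi> i = \<theta> i" "dual_eig scale \<Phi> i = \<theta>s i"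
proof -
  have uniq: "c = \<theta> i"
    if e: "eigenbasis scale d V A \<theta> u" and P: "primitive_idempotent scale V A (\<theta> i) P"
      and c: "primitive_idempotent scale V A c P" for V A \<theta> u c P
  proof -
    obtain k where k: "k \<le> d" "c = \<theta> k"
      using c is_eigenvalue_iff[OF e] by (auto simp: primitive_idempotent_def)
    have "P (u k) = u k" using c k by (simp add: primitive_idempotent_iff[OF e])
    then have "k = i"
      using P k(1) eigenbasisD(7)[OF e k(1)]
      by (auto simp: primitive_idempotent_iff[OF e i] split: if_splits)
    then show ?thesis using k by simp
  qed
  show "eig scale \<Phi> i = \<theta> i" "dual_eig scale \<Phi> i = \<theta>s i"
    using f i uniq unfolding eig_def dual_eig_def eigenframe_def
    by (intro the_equality; blast)+
qed

text \<open>The TH conditions become conditions on vectors: \<open>A\<^sup>*\<close> raises the flag of the \<open>u\<^sub>j\<close> by exactly one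
  step, and \<open>A\<close> raises that of the \<open>v\<^sub>j\<close>.\<close>

lemma TH_systems_iff:
  "\<Phi> \<in> TH_systems scale d \<longleftrightarrow> (\<exists>\<theta> u \<theta>s v. eigenframe scale d \<Phi> \<theta> u \<theta>s v \<and>
     (\<forall>i\<le>d. \<forall>j\<le>d.
       (i > j + 1 \<longrightarrow> (th_E \<Phi> ! i) (th_As \<Phi> (u j)) = 0 \<and> (th_Es \<Phi> ! i) (th_A \<Phi> (v j)) = 0) \<and>
       (i = j + 1 \<longrightarrow> (th_E \<Phi> ! i) (th_As \<Phi> (u j)) \<noteq> 0 \<and> (th_Es \<Phi> ! i) (th_A \<Phi> (v j)) \<noteq> 0)))"
  (is "_ \<longleftrightarrow> ?R")
proof -
  define V A E As Es where defs: "V = th_space \<Phi>" "A = th_A \<Phi>" "E = th_E \<Phi>" "As = th_As \<Phi>"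
    "Es = th_Es \<Phi>"
  have iff: "(compose V (E ! i) (compose V As (E ! j)) = (\<lambda>x\<in>V. 0) \<longleftrightarrow> (E ! i) (As (u j)) = 0) \<and>
      (compose V (Es ! i) (compose V A (Es ! j)) = (\<lambda>x\<in>V. 0) \<longleftrightarrow> (Es ! i) (A (v j)) = 0)"
    if f: "eigenframe scale d \<Phi> \<theta> u \<theta>s v" and ij: "i \<le> d" "j \<le> d" for \<theta> u \<theta>s v i j
  proof -
    have e: "eigenbasis scale d V A \<theta> u" "eigenbasis scale d V As \<theta>s v"
      "primitive_idempotent scale V A (\<theta> j) (E ! j)" "E ! i \<in> End scale V"
      "primitive_idempotent scale V As (\<theta>s j) (Es ! j)" "Es ! i \<in> End scale V"
      using f ij unfolding eigenframe_def defs by (auto simp: primitive_idempotent_def)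
    show ?thesis
      using compose_eq_0_iff[OF e(1) ij(2) e(4) eigenbasisD(4)[OF e(2)] e(3)]
        compose_eq_0_iff[OF e(2) ij(2) e(6) eigenbasisD(4)[OF e(1)] e(5)] by simp
  qed
  show ?thesis
  proof
    assume \<Phi>: "\<Phi> \<in> TH_systems scale d"
    then have h: "subspace V" "dim V = Suc d" "multiplicity_free scale V A" "multiplicity_free scale V As"
      "length E = Suc d" "idempotent_ordering scale V A E"
      "length Es = Suc d" "idempotent_ordering scale V As Es"
      by (simp_all add: TH_systems_def Let_def defs)
    obtain \<theta> u where u: "eigenbasis scale d V A \<theta> u"
      "\<And>i. i \<le> d \<Longrightarrow> primitive_idempotent scale V A (\<theta> i) (E ! i)"
      using eigenbasis_exists[OF h(1,2,3,5,6)] by blast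
    obtain \<theta>s v where v: "eigenbasis scale d V As \<theta>s v"
      "\<And>i. i \<le> d \<Longrightarrow> primitive_idempotent scale V As (\<theta>s i) (Es ! i)"
      using eigenbasis_exists[OF h(1,2,4,7,8)] by blast
    have f: "eigenframe scale d \<Phi> \<theta> u \<theta>s v"
      using u v h(5,7) by (simp add: eigenframe_def defs)
    show ?R
      using \<Phi> f iff[OF f] unfolding TH_systems_def Let_def mem_Collect_eq defs
      by (intro exI[of _ \<theta>] exI[of _ u] exI[of _ \<theta>s] exI[of _ v]) simp
  next
    assume ?R
    then obtain \<theta> u \<theta>s v where f: "eigenframe scale d \<Phi> \<theta> u \<theta>s v" and
      c: "\<forall>i\<le>d. \<forall>j\<le>d.
       (i > j + 1 \<longrightarrow> (E ! i) (As (u j)) = 0 \<and> (Es ! i) (A (v j)) = 0) \<and>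
       (i = j + 1 \<longrightarrow> (E ! i) (As (u j)) \<noteq> 0 \<and> (Es ! i) (A (v j)) \<noteq> 0)"
      unfolding defs by blast
    have e: "eigenbasis scale d V A \<theta> u" "eigenbasis scale d V As \<theta>s v"
      "length E = Suc d" "length Es = Suc d"
      "\<And>i. i \<le> d \<Longrightarrow> primitive_idempotent scale V A (\<theta> i) (E ! i)"
      "\<And>i. i \<le> d \<Longrightarrow> primitive_idempotent scale V As (\<theta>s i) (Es ! i)"
      using f unfolding eigenframe_def defs by auto
    show "\<Phi> \<in> TH_systems scale d"
      unfolding TH_systems_def Let_def mem_Collect_eq defs[symmetric]
      using multiplicity_free_eigenbasis[OF e(1)] multiplicity_free_eigenbasis[OF e(2)]
        idempotent_ordering_eigenbasis[OF e(1,3,5)] idempotent_ordering_eigenbasis[OF e(2,4,6)]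
        eigenbasisD(2,3)[OF e(1)] e(3,4) iff[OF f] c
      by simp
  qed
qed

end

section \<open>The split basis\<close>

lemma last_nonzero_index:
  fixes c :: "nat \<Rightarrow> 'a::zero"
  assumes "j \<le> d" "c j \<noteq> 0"
  obtains m where "j \<le> m" "m \<le> d" "c m \<noteq> 0" "\<And>i. m < i \<Longrightarrow> i \<le> d \<Longrightarrow> c i = 0"
proof -
  define H where "H = {i. i \<le> d \<and> c i \<noteq> 0}"
  have H: "finite H" "j \<in> H" using assms by (auto simp: H_def)
  have m: "j \<le> Max H" "Max H \<in> H" using Max_ge[OF H] Max_in[of H] H by blast+
  have above: "c i = 0" if "Max H < i" "i \<le> d" for i
  proof (rule ccontr)
    assume "c i \<noteq> 0"
    then have "i \<le> Max H" using that by (intro Max_ge[OF H(1)]) (simp add: H_def)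
    then show False using that by simp
  qed
  from m(2) have "Max H \<le> d" "c (Max H) \<noteq> 0" unfolding H_def by blast+
  from that[OF m(1) this above] show ?thesis .
qed

text \<open>One half of a TH system. The locale is used for \<open>A\<close> and for \<open>A\<^sup>*\<close>, and for different choices of
  eigenvectors with the same idempotents.\<close>

locale idempotent_frame = vector_space scale
  for scale :: "'a::field \<Rightarrow> 'v::ab_group_add \<Rightarrow> 'v" (infixr \<open>*s\<close> 75) +
  fixes d :: nat and V :: "'v set" and A :: "'v \<Rightarrow> 'v" and \<theta> :: "nat \<Rightarrow> 'a"
    and u :: "nat \<Rightarrow> 'v" and E :: "nat \<Rightarrow> 'v \<Rightarrow> 'v"
  assumes eb: "eigenbasis scale d V A \<theta> u"
    and prim: "i \<le> d \<Longrightarrow> primitive_idempotent scale V A (\<theta> i) (E i)"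
begin

lemmas ebD = eigenbasisD[OF eb]

lemma E_End: "i \<le> d \<Longrightarrow> E i \<in> End scale V"
  using prim[of i] by (simp add: primitive_idempotent_iff[OF eb])

lemma E_u: "i \<le> d \<Longrightarrow> j \<le> d \<Longrightarrow> E i (u j) = (if j = i then u j else 0)"
  using prim[of i] by (simp add: primitive_idempotent_iff[OF eb])

lemma E_in: "i \<le> d \<Longrightarrow> x \<in> V \<Longrightarrow> E i x \<in> V"
  using EndD(2)[OF E_End] .

lemma E_comb:
  assumes "i \<le> d"
  shows "E i (\<Sum>j\<le>d. c j *s u j) = c i *s u i"
proof -
  have "E i (\<Sum>j\<le>d. c j *s u j) = (\<Sum>j\<le>d. c j *s E i (u j))"
    using lin_on_comb[OF EndD(1)[OF E_End[OF assms]] ebD(2), of "{..d}" u c] ebD(6) by simp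
  also have "\<dots> = (\<Sum>j\<le>d. if j = i then c i *s u i else 0)"
    using E_u[OF assms] by (intro sum.cong) auto
  finally show ?thesis using assms by simp
qed

lemma E_expand:
  assumes "x \<in> V"
  obtains c where "x = (\<Sum>j\<le>d. c j *s u j)" "\<And>i. i \<le> d \<Longrightarrow> E i x = c i *s u i"
  using basis_seq_expand[OF ebD(1) assms] E_comb by blast

lemma sum_E: "x \<in> V \<Longrightarrow> (\<Sum>i\<le>d. E i x) = x"
  by (erule E_expand) simp

lemma E_A:
  assumes "i \<le> d" "x \<in> V"
  shows "E i (A x) = \<theta> i *s E i x"
proof -
  obtain c where c: "x = (\<Sum>j\<le>d. c j *s u j)" "E i x = c i *s u i"
    using E_expand[OF assms(2)] assms(1) by blast
  have "A x = (\<Sum>j\<le>d. (c j * \<theta> j) *s u j)"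
    unfolding c(1) using lin_on_comb[OF EndD(1)[OF ebD(4)] ebD(2), of "{..d}" u c] ebD(6,8)
    by simp
  then show ?thesis using E_comb[OF assms(1), of "\<lambda>j. c j * \<theta> j"] c(2) by (simp add: mult.commute)
qed

lemma E_0: "i \<le> d \<Longrightarrow> E i 0 = 0"
  using lin_on_0[OF EndD(1)[OF E_End] ebD(2)] .

lemma E_diff: "i \<le> d \<Longrightarrow> x \<in> V \<Longrightarrow> y \<in> V \<Longrightarrow> E i (x - y) = E i x - E i y"
  using lin_on_diff[OF EndD(1)[OF E_End] ebD(2)] .

lemma E_E:
  assumes "i \<le> d" "j \<le> d" "x \<in> V"
  shows "E i (E j x) = (if j = i then E j x else 0)"
proof -
  obtain c where "E j x = c *s u j" using E_expand[OF assms(3)] assms(2) by blast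
  then show ?thesis
    using EndD(3)[OF E_End[OF assms(1)] ebD(6)[OF assms(2)]] E_u[OF assms(1,2)]
    by (cases "j = i") auto
qed

text \<open>The flag \<open>E\<^sub>0 V + \<cdots> + E\<^sub>i V\<close> is cut out by linear equations. Membership in a split space, an
  intersection of two such flags, is then checked by computing components.\<close>

lemma flag_eq:
  assumes i: "i \<le> d"
  shows "{(\<Sum>k\<le>i. x k) | x. \<forall>k\<le>i. x k \<in> E k ` V} =
    {x \<in> V. \<forall>k. i < k \<longrightarrow> k \<le> d \<longrightarrow> E k x = 0}"
proof (intro equalityI subsetI)
  fix y assume "y \<in> {(\<Sum>k\<le>i. x k) | x. \<forall>k\<le>i. x k \<in> E k ` V}"
  then obtain x where y: "y = (\<Sum>k\<le>i. x k)" and x: "\<And>k. k \<le> i \<Longrightarrow> x k \<in> E k ` V" by auto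
  have xV: "x k \<in> V" if "k \<le> i" for k using x[OF that] E_in[of k] that i by auto
  have "E k y = 0" if k: "i < k" "k \<le> d" for k
  proof -
    have "E k y = (\<Sum>j\<le>i. E k (x j))"
      unfolding y using lin_on_sum[OF EndD(1)[OF E_End[OF k(2)]] ebD(2), of "{..i}" x] xV by simp
    also have "\<dots> = 0"
    proof (intro sum.neutral ballI)
      fix j assume j: "j \<in> {..i}"
      then obtain z where "z \<in> V" "x j = E j z" using x[of j] by auto
      then show "E k (x j) = 0" using E_E[of k j z] k i j by simp
    qed
    finally show ?thesis .
  qed
  moreover have "y \<in> V" unfolding y using xV by (intro subspace_sum[OF ebD(2)]) auto
  ultimately show "y \<in> {x \<in> V. \<forall>k. i < k \<longrightarrow> k \<le> d \<longrightarrow> E k x = 0}" by simp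
next
  fix y assume y: "y \<in> {x \<in> V. \<forall>k. i < k \<longrightarrow> k \<le> d \<longrightarrow> E k x = 0}"
  then have "y = (\<Sum>k\<le>d. E k y)" using sum_E by simp
  also have "\<dots> = (\<Sum>k\<le>i. E k y)"
    using y i by (intro sum.mono_neutral_right) auto
  finally show "y \<in> {(\<Sum>k\<le>i. x k) | x. \<forall>k\<le>i. x k \<in> E k ` V}"
    using y by (intro CollectI exI[of _ "\<lambda>k. E k y"]) auto
qed

end

locale TH_eigenbases =
  vector_space scale +
  frame: idempotent_frame scale d V A \<theta> u E + dual: idempotent_frame scale d V As \<theta>s v Es
  for scale :: "'a::field \<Rightarrow> 'v::ab_group_add \<Rightarrow> 'v" (infixr \<open>*s\<close> 75)
    and d :: nat and V :: "'v set" and A As :: "'v \<Rightarrow> 'v" and \<theta> \<theta>s :: "nat \<Rightarrow> 'a"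
    and u v :: "nat \<Rightarrow> 'v" and E Es :: "nat \<Rightarrow> 'v \<Rightarrow> 'v" +
  assumes E_As_u: "j + 1 < i \<Longrightarrow> i \<le> d \<Longrightarrow> E i (As (u j)) = 0"
      "j < d \<Longrightarrow> E (Suc j) (As (u j)) \<noteq> 0"
    and Es_A_v: "j + 1 < i \<Longrightarrow> i \<le> d \<Longrightarrow> Es i (A (v j)) = 0"
      "j < d \<Longrightarrow> Es (Suc j) (A (v j)) \<noteq> 0"
begin

lemma E_As_E:
  assumes "j \<le> d" "i \<le> d" "x \<in> V"
  shows "j + 1 < i \<Longrightarrow> E i (As (E j x)) = 0" "i = Suc j \<Longrightarrow> E i (As (E j x)) = 0 \<longleftrightarrow> E j x = 0"
proof -
  obtain c where c: "E j x = c *s u j" using frame.E_expand[OF assms(3)] assms(1) by blast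
  have "E i (As (E j x)) = c *s E i (As (u j))"
    unfolding c using EndD(3)[OF dual.ebD(4) frame.ebD(6)[OF assms(1)]]
      EndD(3)[OF frame.E_End[OF assms(2)] EndD(2)[OF dual.ebD(4) frame.ebD(6)[OF assms(1)]]] by simp
  then show "j + 1 < i \<Longrightarrow> E i (As (E j x)) = 0" "i = Suc j \<Longrightarrow> E i (As (E j x)) = 0 \<longleftrightarrow> E j x = 0"
    using E_As_u(1)[of j i] E_As_u(2)[of j] assms c frame.ebD(7)[OF assms(1)] by auto
qed

lemma Es_A_Es:
  assumes "j \<le> d" "i \<le> d" "x \<in> V"
  shows "j + 1 < i \<Longrightarrow> Es i (A (Es j x)) = 0" "i = Suc j \<Longrightarrow> Es i (A (Es j x)) = 0 \<longleftrightarrow> Es j x = 0"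
proof -
  obtain c where c: "Es j x = c *s v j" using dual.E_expand[OF assms(3)] assms(1) by blast
  have "Es i (A (Es j x)) = c *s Es i (A (v j))"
    unfolding c using EndD(3)[OF frame.ebD(4) dual.ebD(6)[OF assms(1)]]
      EndD(3)[OF dual.E_End[OF assms(2)] EndD(2)[OF frame.ebD(4) dual.ebD(6)[OF assms(1)]]] by simp
  then show "j + 1 < i \<Longrightarrow> Es i (A (Es j x)) = 0" "i = Suc j \<Longrightarrow> Es i (A (Es j x)) = 0 \<longleftrightarrow> Es j x = 0"
    using Es_A_v(1)[of j i] Es_A_v(2)[of j] assms c dual.ebD(7)[OF assms(1)] by auto
qed

lemma E_As_sum:
  assumes "i \<le> d" "x \<in> V"
  shows "E i (As x) = (\<Sum>j\<le>d. E i (As (E j x)))"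
proof -
  have "E i (As x) = E i (As (\<Sum>j\<le>d. E j x))" using frame.sum_E[OF assms(2)] by simp
  also have "As (\<Sum>j\<le>d. E j x) = (\<Sum>j\<le>d. As (E j x))"
    using frame.E_in assms(2) by (intro lin_on_sum[OF EndD(1)[OF dual.ebD(4)] frame.ebD(2)]) auto
  also have "E i \<dots> = (\<Sum>j\<le>d. E i (As (E j x)))"
    using frame.E_in assms(2) EndD(2)[OF dual.ebD(4)]
    by (intro lin_on_sum[OF EndD(1)[OF frame.E_End[OF assms(1)]] frame.ebD(2)]) auto
  finally show ?thesis .
qed

lemma Es_A_sum:
  assumes "i \<le> d" "x \<in> V"
  shows "Es i (A x) = (\<Sum>j\<le>d. Es i (A (Es j x)))"
proof -
  have "Es i (A x) = Es i (A (\<Sum>j\<le>d. Es j x))" using dual.sum_E[OF assms(2)] by simp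
  also have "A (\<Sum>j\<le>d. Es j x) = (\<Sum>j\<le>d. A (Es j x))"
    using dual.E_in assms(2) by (intro lin_on_sum[OF EndD(1)[OF frame.ebD(4)] frame.ebD(2)]) auto
  also have "Es i \<dots> = (\<Sum>j\<le>d. Es i (A (Es j x)))"
    using dual.E_in assms(2) EndD(2)[OF frame.ebD(4)]
    by (intro lin_on_sum[OF EndD(1)[OF dual.E_End[OF assms(1)]] frame.ebD(2)]) auto
  finally show ?thesis .
qed

text \<open>The recursion follows \<open>(A - \<theta>\<^bsub>d-h\<^esub>) U\<^sub>h = U\<^bsub>h+1\<^esub>\<close>, starting from a vector of the first split space
  \<open>U\<^sub>0 = E\<^sup>*\<^sub>0 V\<close>.\<close>

primrec w :: "nat \<Rightarrow> 'v" where
  "w 0 = v 0"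
| "w (Suc h) = A (w h) - \<theta> (d - h) *s w h"

lemma w_in: "w h \<in> V"
  by (induction h) (auto simp: dual.ebD(6) EndD(2)[OF frame.ebD(4)]
      subspace_diff[OF frame.ebD(2)] subspace_scale[OF frame.ebD(2)])

text \<open>Since \<open>E i\<close> composed with \<open>A\<close> is \<open>\<theta> i\<close> times \<open>E i\<close>, every factor \<open>A - \<theta> (d - l)\<close> contributes a
  scalar.\<close>

lemma E_w:
  assumes "i \<le> d"
  shows "E i (w h) = (\<Prod>l<h. \<theta> i - \<theta> (d - l)) *s E i (w 0)"
proof (induction h)
  case (Suc h)
  have "E i (w (Suc h)) = \<theta> i *s E i (w h) - \<theta> (d - h) *s E i (w h)"
    using frame.E_diff[OF assms EndD(2)[OF frame.ebD(4) w_in]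
        subspace_scale[OF frame.ebD(2) w_in], of h "\<theta> (d - h)" h]
      frame.E_A[OF assms w_in] EndD(3)[OF frame.E_End[OF assms] w_in] by simp
  also have "\<dots> = (\<theta> i - \<theta> (d - h)) *s E i (w h)" by (simp add: scale_left_diff_distrib)
  finally show ?case using Suc.IH by (simp add: mult.commute)
qed simp

lemma E_w_above:
  assumes "d - h < i" "i \<le> d"
  shows "E i (w h) = 0"
proof -
  have "(\<Prod>l<h. \<theta> i - \<theta> (d - l)) = 0"
    \<comment> \<open>The factor with \<open>l = d - i\<close> vanishes.\<close>
    using assms by (intro prod_zero) (auto intro!: bexI[of _ "d - i"])
  then show ?thesis using E_w[OF assms(2)] by simp
qed

text \<open>By the TH condition for \<open>A\<close>, each step of the recursion raises the flag of the \<open>v\<^sub>j\<close> by exactly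
  one.\<close>

lemma Es_w:
  assumes "h \<le> d"
  shows "(\<forall>k. h < k \<longrightarrow> k \<le> d \<longrightarrow> Es k (w h) = 0) \<and> Es h (w h) \<noteq> 0"
  using assms
proof (induction h)
  case 0
  show ?case using dual.E_u[of _ 0] dual.ebD(7)[of 0] by auto
next
  case (Suc h)
  have IH: "\<And>k. h < k \<Longrightarrow> k \<le> d \<Longrightarrow> Es k (w h) = 0" "Es h (w h) \<noteq> 0" using Suc by auto
  have step: "Es k (w (Suc h)) = Es k (A (Es h (w h)))" if k: "h < k" "k \<le> d" for k
  proof -
    have "Es k (w (Suc h)) = Es k (A (w h)) - \<theta> (d - h) *s Es k (w h)"
      using dual.E_diff[OF k(2) EndD(2)[OF frame.ebD(4) w_in]
          subspace_scale[OF frame.ebD(2) w_in], of h "\<theta> (d - h)" h]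
        EndD(3)[OF dual.E_End[OF k(2)] w_in] by simp
    also have "\<dots> = (\<Sum>j\<le>d. Es k (A (Es j (w h))))"
      using IH(1)[OF k] Es_A_sum[OF k(2) w_in] by simp
    also have "\<dots> = (\<Sum>j\<in>{h}. Es k (A (Es j (w h))))"
    proof (intro sum.mono_neutral_right ballI)
      fix j assume j: "j \<in> {..d} - {h}"
      show "Es k (A (Es j (w h))) = 0"
      proof (cases "j < h")
        case True
        then show ?thesis using Es_A_Es(1)[of j k "w h"] k w_in by simp
      next
        case False
        then show ?thesis
          using IH(1)[of j] j k(2) lin_on_0[OF EndD(1)[OF frame.ebD(4)] frame.ebD(2)] dual.E_0
          by simp
      qed
    qed (use Suc.prems in auto)
    finally show ?thesis by simp
  qed
  show ?case
    using step Es_A_Es[of h _ "w h"] IH(2) Suc.prems w_in by simp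
qed

text \<open>The vectors \<open>w h\<close> are triangular with respect to the flag of the \<open>v\<^sub>j\<close>: if \<open>m\<close> is the last index
  with \<open>c m \<noteq> 0\<close>, then \<open>Es m\<close> does not annihilate the sum.\<close>

lemma w_upper:
  assumes x: "\<And>k. i < k \<Longrightarrow> k \<le> d \<Longrightarrow> Es k (\<Sum>h\<le>d. c h *s w h) = 0" and h: "i < h" "h \<le> d"
  shows "c h = 0"
proof (rule ccontr)
  assume "c h \<noteq> 0"
  then obtain m where m: "h \<le> m" "m \<le> d" "c m \<noteq> 0"
    and above: "\<And>h. m < h \<Longrightarrow> h \<le> d \<Longrightarrow> c h = 0"
    using last_nonzero_index[where c = c, OF h(2)] by blast
  have im: "i < m" using m(1) h(1) by simp
  have "0 = (\<Sum>h\<le>d. c h *s Es m (w h))"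
    using x[OF im m(2)] lin_on_comb[OF EndD(1)[OF dual.E_End[OF m(2)]] frame.ebD(2), of "{..d}" w c]
      w_in by simp
  also have "\<dots> = (\<Sum>h\<in>{m}. c h *s Es m (w h))"
  proof (intro sum.mono_neutral_right ballI)
    fix h assume "h \<in> {..d} - {m}"
    then show "c h *s Es m (w h) = 0" using Es_w[of h] above[of h] m(2) by (cases "h < m") auto
  qed (use m in auto)
  finally show False using m Es_w[OF m(2)] by simp
qed

lemma w_basis: "basis_seq scale d V w"
proof (rule independent_basis_seq[OF frame.ebD(2,3) w_in])
  fix c i assume c: "(\<Sum>h\<le>d. c h *s w h) = 0" and i: "i \<le> d"
  have pos: "c h = 0" if "0 < h" "h \<le> d" for h
    using w_upper[of 0 c h] that c dual.E_0 by simp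
  have "(\<Sum>h\<le>d. c h *s w h) = (\<Sum>h\<in>{0}. c h *s w h)"
    using pos by (intro sum.mono_neutral_right) auto
  then have "c 0 = 0" using c dual.ebD(7)[of 0] by simp
  then show "c i = 0" using pos[of i] i by (cases "i = 0") auto
qed

text \<open>The map \<open>E i\<close> is nonzero, and its values on the basis \<open>w\<close> are multiples of \<open>E i (w 0)\<close>.\<close>

lemma E_w0:
  assumes "i \<le> d"
  shows "E i (w 0) \<noteq> 0"
proof
  assume 0: "E i (w 0) = 0"
  obtain c where c: "u i = (\<Sum>h\<le>d. c h *s w h)"
    using basis_seq_expand[OF w_basis frame.ebD(6)[OF assms]] ..
  have "u i = E i (u i)" using frame.E_u[OF assms assms] by simp
  also have "\<dots> = (\<Sum>h\<le>d. c h *s E i (w h))"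
    unfolding c using lin_on_comb[OF EndD(1)[OF frame.E_End[OF assms]] frame.ebD(2), of "{..d}" w c]
      w_in by simp
  also have "\<dots> = 0"
  proof (intro sum.neutral ballI)
    show "c h *s E i (w h) = 0" for h using E_w[OF assms, of h] 0 by simp
  qed
  finally show False using frame.ebD(7)[OF assms] by simp
qed

lemma E_w_diag:
  assumes "h \<le> d"
  shows "E (d - h) (w h) \<noteq> 0"
proof -
  have "\<theta> (d - h) - \<theta> (d - l) \<noteq> 0" if "l < h" for l
    using inj_onD[OF frame.ebD(5), of "d - h" "d - l"] that assms by auto
  then have "(\<Prod>l<h. \<theta> (d - h) - \<theta> (d - l)) \<noteq> 0" by auto
  then show ?thesis using E_w[of "d - h" h] E_w0[of "d - h"] by simp
qed

text \<open>Triangularity in the other direction: \<open>E (d - h)\<close> annihilates \<open>w k\<close> for \<open>k > h\<close> but not \<open>w h\<close>, so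
  the coefficients vanish successively from the bottom.\<close>

lemma w_lower:
  assumes x: "\<And>h. h < i \<Longrightarrow> h \<le> d \<Longrightarrow> E (d - h) (\<Sum>h\<le>d. c h *s w h) = 0"
  shows "h < i \<Longrightarrow> h \<le> d \<Longrightarrow> c h = 0"
proof (induction h rule: less_induct)
  case (less m)
  have "0 = (\<Sum>h\<le>d. c h *s E (d - m) (w h))"
    using x[OF less.prems] w_in
      lin_on_comb[OF EndD(1)[OF frame.E_End[of "d - m"]] frame.ebD(2), of "{..d}" w c] by simp
  also have "\<dots> = (\<Sum>h\<in>{m}. c h *s E (d - m) (w h))"
  proof (intro sum.mono_neutral_right ballI)
    fix h assume h: "h \<in> {..d} - {m}"
    show "c h *s E (d - m) (w h) = 0"
    proof (cases "h < m")
      case True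
      then show ?thesis using less.IH[of h] less.prems by simp
    next
      case False
      then have "d - h < d - m" using h by auto
      then show ?thesis using E_w_above[of h "d - m"] by simp
    qed
  qed (use less.prems in auto)
  finally show ?case using E_w_diag[OF less.prems(2)] by simp
qed

text \<open>One flag bounds the indices of the \<open>w h\<close> that occur from above by \<open>i\<close>, the other one from
  below.\<close>

lemma split_component:
  assumes i: "i \<le> d"
  shows "{x \<in> V. \<forall>k. i < k \<longrightarrow> k \<le> d \<longrightarrow> Es k x = 0} \<inter>
      {x \<in> V. \<forall>k. d - i < k \<longrightarrow> k \<le> d \<longrightarrow> E k x = 0} = range (\<lambda>c. c *s w i)" (is "?U = _")
proof (intro equalityI subsetI)
  fix x assume x: "x \<in> ?U"
  obtain c where c: "x = (\<Sum>h\<le>d. c h *s w h)" using basis_seq_expand[OF w_basis, of x] x by auto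
  have Es: "Es k (\<Sum>h\<le>d. c h *s w h) = 0" if "i < k" "k \<le> d" for k
    using x that unfolding c by blast
  have E: "E (d - h) (\<Sum>h\<le>d. c h *s w h) = 0" if "h < i" "h \<le> d" for h
  proof -
    have "d - i < d - h" "d - h \<le> d" using that i by auto
    then show ?thesis using x unfolding c by blast
  qed
  have "c h = 0" if "h \<le> d" "h \<noteq> i" for h
    using w_upper[of i c, OF Es _ that(1)] w_lower[of i c, OF E _ that(1)] that(2)
    by (meson linorder_neqE_nat)
  then have "x = (\<Sum>h\<in>{i}. c h *s w h)"
    unfolding c using i by (intro sum.mono_neutral_right) auto
  then have "x = c i *s w i" by simp
  then show "x \<in> range (\<lambda>c. c *s w i)" by blast
next
  fix x assume "x \<in> range (\<lambda>c. c *s w i)"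
  then obtain c where c: "x = c *s w i" by blast
  show "x \<in> ?U"
    using Es_w[OF i] E_w_above[of i] EndD(3)[OF frame.E_End w_in] EndD(3)[OF dual.E_End w_in]
      subspace_scale[OF frame.ebD(2) w_in]
    by (auto simp: c)
qed

lemma As_w0: "As (w 0) = \<theta>s 0 *s w 0"
  using dual.ebD(8)[of 0] by simp

text \<open>The vector \<open>y = (A\<^sup>* - \<theta>\<^sup>*\<^bsub>i+1\<^esub>) w\<^bsub>i+1\<^esub>\<close> lies in \<open>U\<^sub>i\<close>: subtracting the eigenvalue removes the top
  component of \<open>w\<^bsub>i+1\<^esub>\<close> with respect to the \<open>v\<^sub>j\<close>, and \<open>A\<^sup>*\<close> raises the flag of the \<open>u\<^sub>j\<close> by at most
  one step. It is nonzero because the component of \<open>w\<^bsub>i+1\<^esub>\<close> in \<open>E\<^bsub>d-i-1\<^esub> V\<close> is raised by exactly one step.\<close>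

lemma As_w:
  assumes i: "i < d"
  shows "\<exists>\<phi>. \<phi> \<noteq> 0 \<and> As (w (Suc i)) = \<theta>s (Suc i) *s w (Suc i) + \<phi> *s w i"
proof -
  note w.simps [simp del]
  define y where "y = As (w (Suc i)) - \<theta>s (Suc i) *s w (Suc i)"
  have yV: "y \<in> V" unfolding y_def
    by (intro subspace_diff[OF frame.ebD(2)] subspace_scale[OF frame.ebD(2)] EndD(2)[OF dual.ebD(4)] w_in)
  have Es_y: "Es k y = 0" if "i < k" "k \<le> d" for k
  proof -
    have "Es k y = \<theta>s k *s Es k (w (Suc i)) - \<theta>s (Suc i) *s Es k (w (Suc i))"
      unfolding y_def using dual.E_diff[OF that(2) EndD(2)[OF dual.ebD(4) w_in]
          subspace_scale[OF frame.ebD(2) w_in]] dual.E_A[OF that(2) w_in]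
        EndD(3)[OF dual.E_End[OF that(2)] w_in] by simp
    also have "\<dots> = 0" using Es_w[of "Suc i"] i that by (cases "k = Suc i") auto
    finally show ?thesis .
  qed
  have E_y: "E k y = E k (As (E (d - Suc i) (w (Suc i))))" if "d - Suc i < k" "k \<le> d" for k
  proof -
    have "E k y = E k (As (w (Suc i)))"
      unfolding y_def using frame.E_diff[OF that(2) EndD(2)[OF dual.ebD(4) w_in]
          subspace_scale[OF frame.ebD(2) w_in]] E_w_above[of "Suc i" k] that
        EndD(3)[OF frame.E_End[OF that(2)] w_in] by simp
    also have "\<dots> = (\<Sum>j\<le>d. E k (As (E j (w (Suc i)))))"
      by (rule E_As_sum[OF that(2) w_in])
    also have "\<dots> = (\<Sum>j\<in>{d - Suc i}. E k (As (E j (w (Suc i)))))"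
    proof (intro sum.mono_neutral_right ballI)
      fix j assume j: "j \<in> {..d} - {d - Suc i}"
      show "E k (As (E j (w (Suc i)))) = 0"
      proof (cases "j < d - Suc i")
        case True
        then show ?thesis using E_As_E(1)[of j k "w (Suc i)"] that w_in by simp
      next
        case False
        then show ?thesis
          using E_w_above[of "Suc i" j] j that(2)
            lin_on_0[OF EndD(1)[OF dual.ebD(4)] frame.ebD(2)] frame.E_0
          by simp
      qed
    qed auto
    finally show ?thesis by simp
  qed
  have "E k y = 0" if "d - i < k" "k \<le> d" for k
    using E_y[of k] E_As_E(1)[of "d - Suc i" k "w (Suc i)"] that i w_in by simp
  then have "y \<in> {x \<in> V. \<forall>k. i < k \<longrightarrow> k \<le> d \<longrightarrow> Es k x = 0} \<inter>
      {x \<in> V. \<forall>k. d - i < k \<longrightarrow> k \<le> d \<longrightarrow> E k x = 0}"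
    using Es_y yV by simp
  then have "y \<in> range (\<lambda>c. c *s w i)"
    unfolding split_component[OF less_imp_le[OF i]] .
  then obtain \<phi> where \<phi>: "y = \<phi> *s w i" by blast
  have "E (d - i) y \<noteq> 0"
  proof -
    have "d - i = Suc (d - Suc i)" "d - Suc i < d - i" using i by auto
    from E_As_E(2)[OF _ _ w_in this(1), of "Suc i"] E_w_diag[of "Suc i"] i E_y[OF this(2)]
    show ?thesis by auto
  qed
  then have "\<phi> \<noteq> 0" using \<phi> frame.E_0 by auto
  moreover have "As (w (Suc i)) = \<theta>s (Suc i) *s w (Suc i) + \<phi> *s w i"
    using \<phi> by (simp add: y_def algebra_simps)
  ultimately show ?thesis by blast
qed

end

section \<open>Graded sequences of polynomials\<close>

lemma degree_triangular_sum:
  fixes p :: "nat \<Rightarrow> 'a::field poly"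
  assumes p: "\<And>h. h \<le> d \<Longrightarrow> degree (p h) = h" "p 0 \<noteq> 0"
    and j: "j \<le> d" "c j \<noteq> 0" and c: "\<And>h. j < h \<Longrightarrow> h \<le> d \<Longrightarrow> c h = 0"
  shows "degree (\<Sum>h\<le>d. Polynomial.smult (c h) (p h)) = j" "(\<Sum>h\<le>d. Polynomial.smult (c h) (p h)) \<noteq> 0"
proof -
  have "(\<Sum>h\<le>d. Polynomial.smult (c h) (p h)) = (\<Sum>h\<le>j. Polynomial.smult (c h) (p h))"
    using j c by (intro sum.mono_neutral_right) auto
  also have "\<dots> = (\<Sum>h<j. Polynomial.smult (c h) (p h)) + Polynomial.smult (c j) (p j)"
    by (simp flip: lessThan_Suc_atMost)
  finally have s: "(\<Sum>h\<le>d. Polynomial.smult (c h) (p h)) =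
      (\<Sum>h<j. Polynomial.smult (c h) (p h)) + Polynomial.smult (c j) (p j)" .
  have "degree (\<Sum>h\<le>d. Polynomial.smult (c h) (p h)) = j \<and> (\<Sum>h\<le>d. Polynomial.smult (c h) (p h)) \<noteq> 0"
  proof (cases "j = 0")
    case True
    then show ?thesis using s p(1)[of 0] p(2) j by simp
  next
    case False
    have "degree (\<Sum>h<j. Polynomial.smult (c h) (p h)) < j"
    proof (rule degree_sum_less)
      fix h assume "h \<in> {..<j}"
      then show "degree (Polynomial.smult (c h) (p h)) < j"
        using p(1)[of h] j(1) degree_smult_le[of "c h" "p h"] by simp
    qed (use False in simp)
    moreover have "degree (Polynomial.smult (c j) (p j)) = j" using p(1)[OF j(1)] j(2) by simp
    ultimately have "degree (\<Sum>h\<le>d. Polynomial.smult (c h) (p h)) = j"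
      unfolding s by (simp add: degree_add_eq_right)
    then show ?thesis using False by auto
  qed
  then show "degree (\<Sum>h\<le>d. Polynomial.smult (c h) (p h)) = j"
    "(\<Sum>h\<le>d. Polynomial.smult (c h) (p h)) \<noteq> 0" by simp_all
qed

lemma poly_eq_0_if_distinct_roots:
  fixes p :: "'a::field poly"
  assumes "degree p \<le> d" "inj_on \<theta> {..d}" "\<And>k. k \<le> d \<Longrightarrow> poly p (\<theta> k) = 0"
  shows "p = 0"
proof (rule ccontr)
  assume p: "p \<noteq> 0"
  have "Suc d = card (\<theta> ` {..d})" using assms(2) by (simp add: card_image)
  also have "\<dots> \<le> card {x. poly p x = 0}"
    using assms(3) by (intro card_mono poly_roots_finite[OF p]) auto
  also have "\<dots> \<le> degree p" by (rule card_poly_roots_bound[OF p])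
  finally show False using assms(1) by simp
qed

lemma gradedD:
  assumes "graded d f"
  shows "f 0 = 1" "h \<le> d \<Longrightarrow> degree (f h) = h" "f 0 \<noteq> 0"
  using assms by (auto simp: graded_def)

lemma graded_leading_index:
  assumes f: "graded d f" and "(\<Sum>i\<le>d. Polynomial.smult (c i) (f i)) = p" "p \<noteq> 0"
  shows "degree p \<le> d" "c (degree p) \<noteq> 0" "degree p < i \<Longrightarrow> i \<le> d \<Longrightarrow> c i = 0"
proof -
  have "\<exists>j\<le>d. c j \<noteq> 0"
  proof (rule ccontr)
    assume "\<not> ?thesis"
    then have "p = 0" unfolding assms(2)[symmetric] by (intro sum.neutral) auto
    then show False using assms(3) by simp
  qed
  then obtain m where m: "m \<le> d" "c m \<noteq> 0" and above: "\<And>i. m < i \<Longrightarrow> i \<le> d \<Longrightarrow> c i = 0"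
    using last_nonzero_index[of _ d c] by metis
  have "degree p = m"
    using degree_triangular_sum(1)[where p = f and c = c,
        OF gradedD(2)[OF f] gradedD(3)[OF f] m above] assms(2) by simp
  then show "degree p \<le> d" "c (degree p) \<noteq> 0" "degree p < i \<Longrightarrow> i \<le> d \<Longrightarrow> c i = 0"
    using m above by simp_all
qed

lemma degree_graded_sum_le:
  assumes "graded d f"
  shows "degree (\<Sum>i\<le>d. Polynomial.smult (c i) (f i)) \<le> d"
  using gradedD(2)[OF assms] degree_smult_le[of _ "f _"]
  by (intro degree_sum_le) (auto intro: order_trans[OF degree_smult_le])

lemma graded_values_independent:
  assumes f: "graded d f" and \<theta>: "inj_on \<theta> {..d}"
    and c: "\<And>k. k \<le> d \<Longrightarrow> (\<Sum>j\<le>d. c j * poly (f j) (\<theta> k)) = 0" and j: "j \<le> d"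
  shows "c j = (0::'a::field)"
proof (rule ccontr)
  assume cj: "c j \<noteq> 0"
  have 0: "(\<Sum>j\<le>d. Polynomial.smult (c j) (f j)) = 0"
    using c by (intro poly_eq_0_if_distinct_roots[OF degree_graded_sum_le[OF f] \<theta>])
      (simp add: poly_sum)
  obtain m where m: "m \<le> d" "c m \<noteq> 0" and above: "\<And>i. m < i \<Longrightarrow> i \<le> d \<Longrightarrow> c i = 0"
    using last_nonzero_index[where c = c, OF j cj] by blast
  show False
    using degree_triangular_sum(2)[where p = f and c = c,
        OF gradedD(2)[OF f] gradedD(3)[OF f] m above] 0 by simp
qed

text \<open>As \<open>j < d\<close>, the polynomial \<open>x f\<^sub>j\<close> has degree \<open>j + 1 \<le> d\<close>. Polynomials of degree at most \<open>d\<close>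
  that agree at \<open>d + 1\<close> points are equal, so the expansion of \<open>x f\<^sub>j\<close> is known to end at index
  \<open>j + 1\<close>.\<close>

lemma graded_recurrence:
  fixes \<theta> :: "nat \<Rightarrow> 'a::field"
  assumes f: "graded d f" and \<theta>: "inj_on \<theta> {..d}" and j: "j < d"
    and c: "\<And>k. k \<le> d \<Longrightarrow> (\<Sum>i\<le>d. c i * poly (f i) (\<theta> k)) = \<theta> k * poly (f j) (\<theta> k)"
  shows "c (Suc j) \<noteq> 0" "j + 1 < i \<Longrightarrow> i \<le> d \<Longrightarrow> c i = 0"
proof -
  let ?s = "\<Sum>i\<le>d. Polynomial.smult (c i) (f i)"
  have fj: "f j \<noteq> 0" "degree (f j) = j"
    using gradedD(2)[OF f, of j] gradedD(3)[OF f] j by (cases "j = 0"; force)+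
  have deg: "degree ([:0, 1:] * f j) = Suc j" "[:0, 1:] * f j \<noteq> 0"
    using fj by (auto simp: degree_mult_eq)
  have "?s - [:0, 1:] * f j = 0"
  proof (rule poly_eq_0_if_distinct_roots[OF _ \<theta>])
    show "degree (?s - [:0, 1:] * f j) \<le> d"
      using degree_graded_sum_le[OF f] deg(1) j by (intro degree_diff_le) auto
    show "poly (?s - [:0, 1:] * f j) (\<theta> k) = 0" if "k \<le> d" for k
      using c[OF that] by (simp add: poly_sum)
  qed
  then have "?s = [:0, 1:] * f j" by simp
  from graded_leading_index[OF f this deg(2)] deg(1)
  show "c (Suc j) \<noteq> 0" "j + 1 < i \<Longrightarrow> i \<le> d \<Longrightarrow> c i = 0" by simp_all
qed

lemma degree_linear_product: "degree (\<Prod>k<h. [:- a k, 1:]) = (h::nat)" for a :: "nat \<Rightarrow> 'a::field"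
proof (induction h)
  case (Suc h)
  have "(\<Prod>k<h. [:- a k, 1:]) \<noteq> 0" by simp
  then have "degree ((\<Prod>k<h. [:- a k, 1:]) * [:- a h, 1:]) =
      degree (\<Prod>k<h. [:- a k, 1:]) + degree [:- a h, 1:]"
    by (intro degree_mult_eq) auto
  then show ?case using Suc.IH by (simp only: prod.lessThan_Suc) simp
qed simp

text \<open>The Newton polynomials \<open>(x - a\<^sub>0) \<cdots> (x - a\<^bsub>h-1\<^esub>)\<close> have degree \<open>h\<close>, and the coefficient array is
  triangular with nonzero diagonal.\<close>

lemma graded_newton:
  fixes a :: "nat \<Rightarrow> 'a::field"
  assumes "\<And>j. j \<le> d \<Longrightarrow> c j 0 = 1" "\<And>j. j \<le> d \<Longrightarrow> c j j \<noteq> 0"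
    "\<And>j h. j < h \<Longrightarrow> h \<le> d \<Longrightarrow> c j h = 0"
  shows "graded d (\<lambda>j. \<Sum>h\<le>d. Polynomial.smult (c j h) (\<Prod>k<h. [:- a k, 1:]))"
  unfolding graded_def
proof (intro conjI allI impI)
  have "(\<Sum>h\<le>d. Polynomial.smult (c 0 h) (\<Prod>k<h. [:- a k, 1:])) =
      (\<Sum>h\<in>{0}. Polynomial.smult (c 0 h) (\<Prod>k<h. [:- a k, 1:]))"
    using assms(3) by (intro sum.mono_neutral_right) auto
  then show "(\<Sum>h\<le>d. Polynomial.smult (c 0 h) (\<Prod>k<h. [:- a k, 1:])) = 1" using assms(1)[of 0] by simp
  fix j assume "j \<le> d"
  then show "degree (\<Sum>h\<le>d. Polynomial.smult (c j h) (\<Prod>k<h. [:- a k, 1:])) = j"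
    using assms by (intro degree_triangular_sum(1)) (auto simp: degree_linear_product)
qed

text \<open>For fixed \<open>j\<close> the entry is a Newton sum in \<open>\<theta>\<^sub>i\<close> with nodes \<open>\<theta>\<^sub>d, \<theta>\<^bsub>d-1\<^esub>, \<dots>\<close>. Its coefficients vanish
  for \<open>h > j\<close> because of the factor \<open>\<theta>\<^sup>*\<^sub>j - \<theta>\<^sup>*\<^sub>j\<close>. For fixed \<open>i\<close> the roles are exchanged, and the terms
  with \<open>h > d - i\<close> contain the factor \<open>\<theta>\<^sub>i - \<theta>\<^sub>i\<close>.\<close>

lemma newton_matrix_vandermonde:
  fixes \<theta> \<theta>s \<phi> :: "nat \<Rightarrow> 'a::field"
  assumes \<theta>: "inj_on \<theta> {..d}" and \<theta>s: "inj_on \<theta>s {..d}"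
    and \<phi>: "\<And>k. 1 \<le> k \<Longrightarrow> k \<le> d \<Longrightarrow> \<phi> k \<noteq> 0"
  shows "(mat (Suc d) (Suc d) (\<lambda>(i, j). \<Sum>h\<le>d.
      ((\<Prod>k<h. \<theta> i - \<theta> (d - k)) * (\<Prod>k<h. \<theta>s j - \<theta>s k)) / (\<Prod>k=1..h. \<phi> k)),
    map \<theta> [0..<Suc d], map \<theta>s [0..<Suc d]) \<in> nws_vandermonde d"
proof -
  have prod: "(\<Prod>k=1..h. \<phi> k) \<noteq> 0" if "h \<le> d" for h using \<phi> that by auto
  have inj: "\<theta> (d - m) \<noteq> \<theta> (d - k)" "\<theta>s m \<noteq> \<theta>s k" if "k < m" "m \<le> d" for k m
    using inj_onD[OF \<theta>, of "d - m" "d - k"] inj_onD[OF \<theta>s, of m k] that by auto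
  define f where "f j = (\<Sum>h\<le>d. Polynomial.smult ((\<Prod>k<h. \<theta>s j - \<theta>s k) / (\<Prod>k=1..h. \<phi> k))
      (\<Prod>k<h. [:- \<theta> (d - k), 1:]))" for j
  define fs where "fs m = (\<Sum>h\<le>d. Polynomial.smult ((\<Prod>k<h. \<theta> (d - m) - \<theta> (d - k)) / (\<Prod>k=1..h. \<phi> k))
      (\<Prod>k<h. [:- \<theta>s k, 1:]))" for m
  have "graded d f" unfolding f_def
    using prod inj by (intro graded_newton) auto
  moreover have "graded d fs" unfolding fs_def
    using prod inj by (intro graded_newton) auto
  moreover have "(\<Sum>h\<le>d. ((\<Prod>k<h. \<theta> i - \<theta> (d - k)) * (\<Prod>k<h. \<theta>s j - \<theta>s k)) / (\<Prod>k=1..h. \<phi> k))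
      = poly (f j) (\<theta> i)" for i j
    by (simp add: f_def poly_sum poly_prod mult.commute)
  moreover have "(\<Sum>h\<le>d. ((\<Prod>k<h. \<theta> i - \<theta> (d - k)) * (\<Prod>k<h. \<theta>s j - \<theta>s k)) / (\<Prod>k=1..h. \<phi> k))
      = poly (fs (d - i)) (\<theta>s j)" if "i \<le> d" for i j
    using that by (simp add: fs_def poly_sum poly_prod)
  moreover have "distinct (map \<theta> [0..<Suc d])" "distinct (map \<theta>s [0..<Suc d])"
    using \<theta> \<theta>s by (simp_all add: distinct_map atLeast0LessThan lessThan_Suc_atMost del: upt_Suc)
  ultimately show ?thesis
    unfolding nws_vandermonde_def mem_Collect_eq case_prod_conv
    by (intro conjI exI[of _ f] exI[of _ fs]) (auto simp: less_Suc_eq_le simp del: upt_Suc)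
qed

section \<open>The transition matrix of a TH system\<close>

context idempotent_frame
begin

lemma eigenbasis_of_eigenvectors:
  assumes "\<And>i. i \<le> d \<Longrightarrow> x i \<in> V" "\<And>i. i \<le> d \<Longrightarrow> x i \<noteq> 0" "\<And>i. i \<le> d \<Longrightarrow> A (x i) = \<theta> i *s x i"
  shows "eigenbasis scale d V A \<theta> x"
proof -
  have "basis_seq scale d V x"
  proof (rule biorthogonal_basis_seq[OF ebD(2,3) assms(1,2) E_End])
    fix i j assume ij: "i \<le> d" "j \<le> d"
    have "x j \<in> eigenspace scale V A (\<theta> j)" using assms(1,3) ij by (simp add: eigenspace_def)
    then show "E i (x j) = (if j = i then x j else 0)"
      using prim[OF ij(1)] inj_onD[OF ebD(5), of j i] ij
      by (cases "j = i") (auto simp: primitive_idempotent_def)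
  qed
  then show ?thesis using ebD assms(3) by (simp add: eigenbasis_def)
qed

end

context TH_eigenbases
begin

text \<open>The superdiagonal entries of \<open>A\<^sup>*\<close> in the basis \<open>w\<close>, which turn out to be the split sequence.\<close>

definition \<phi> :: "nat \<Rightarrow> 'a" where
  "\<phi> i = (SOME c. c \<noteq> 0 \<and> As (w i) = \<theta>s i *s w i + c *s w (i - 1))"

lemma \<phi>:
  assumes "1 \<le> i" "i \<le> d"
  shows "\<phi> i \<noteq> 0" "As (w i) = \<theta>s i *s w i + \<phi> i *s w (i - 1)"
proof -
  have "\<exists>c. c \<noteq> 0 \<and> As (w i) = \<theta>s i *s w i + c *s w (i - 1)"
    using As_w[of "i - 1"] assms by simp
  from someI_ex[OF this] show "\<phi> i \<noteq> 0" "As (w i) = \<theta>s i *s w i + \<phi> i *s w (i - 1)"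
    unfolding \<phi>_def[symmetric] by simp_all
qed

text \<open>On the line through \<open>w\<^sub>i\<close>, the map \<open>A\<^sup>* - \<theta>\<^sup>*\<^sub>i\<close> leads down to \<open>\<phi>\<^sub>i w\<^bsub>i-1\<^esub>\<close>, and \<open>A - \<theta>\<^bsub>d-i+1\<^esub>\<close> leads back up
  to \<open>\<phi>\<^sub>i w\<^sub>i\<close>.\<close>

lemma split_eigenvalue_unique:
  assumes i: "1 \<le> i" "i \<le> d"
  shows "(\<forall>x\<in>range (\<lambda>a. a *s w i). (let y = As x - \<theta>s i *s x in A y - \<theta> (d - i + 1) *s y) = c *s x)
    \<longleftrightarrow> c = \<phi> i"
proof -
  have di: "d - i + 1 = d - (i - 1)" "Suc (i - 1) = i" using i by auto
  have key: "(let y = As x - \<theta>s i *s x in A y - \<theta> (d - i + 1) *s y) = \<phi> i *s x"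
    if x: "x = a *s w i" for x a
  proof -
    have "As x = a *s (\<theta>s i *s w i + \<phi> i *s w (i - 1))"
      unfolding x using EndD(3)[OF dual.ebD(4) w_in] \<phi>(2)[OF i] by simp
    then have y: "As x - \<theta>s i *s x = (a * \<phi> i) *s w (i - 1)"
      unfolding x by (simp add: scale_right_distrib mult.commute)
    have "A (w (i - 1)) = w i + \<theta> (d - (i - 1)) *s w (i - 1)"
      using w.simps(2)[of "i - 1"] unfolding di(2) by simp
    then have "A ((a * \<phi> i) *s w (i - 1)) - \<theta> (d - (i - 1)) *s ((a * \<phi> i) *s w (i - 1)) =
        (a * \<phi> i) *s w i"
      using EndD(3)[OF frame.ebD(4) w_in]
      by (simp add: scale_right_distrib mult.commute)
    then show ?thesis unfolding Let_def y di(1) by (simp add: x mult.commute)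
  qed
  have wi: "w i \<in> range (\<lambda>a. a *s w i)" using rangeI[of "\<lambda>a. a *s w i" 1] by simp
  show ?thesis
  proof
    assume c: "\<forall>x\<in>range (\<lambda>a. a *s w i).
      (let y = As x - \<theta>s i *s x in A y - \<theta> (d - i + 1) *s y) = c *s x"
    have "c *s w i = \<phi> i *s w i"
      using bspec[OF c wi] key[of "w i" 1] by simp
    then show "c = \<phi> i" using basis_seq_nonzero[OF w_basis i(2)] by simp
  next
    assume "c = \<phi> i"
    then show "\<forall>x\<in>range (\<lambda>a. a *s w i).
      (let y = As x - \<theta>s i *s x in A y - \<theta> (d - i + 1) *s y) = c *s x"
      using key by blast
  qed
qed

text \<open>The solution, with value \<open>1\<close> at \<open>h = 0\<close>, of the recurrence
  \<open>c\<^bsub>h+1\<^esub> \<phi>\<^bsub>h+1\<^esub> = c\<^sub>h (\<theta>\<^sup>*\<^sub>j - \<theta>\<^sup>*\<^sub>h)\<close> for the coordinates of an eigenvector of \<open>A\<^sup>*\<close> in the basis \<open>w\<close>.\<close>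

definition dual_coeff :: "nat \<Rightarrow> nat \<Rightarrow> 'a" where
  "dual_coeff j h = (\<Prod>k<h. \<theta>s j - \<theta>s k) / (\<Prod>k=1..h. \<phi> k)"

definition dual_vec :: "nat \<Rightarrow> 'v" where
  "dual_vec j = (\<Sum>h\<le>d. dual_coeff j h *s w h)"

lemma dual_coeff_Suc:
  assumes "h < d"
  shows "dual_coeff j (Suc h) * \<phi> (Suc h) = dual_coeff j h * (\<theta>s j - \<theta>s h)"
proof -
  have "(\<Prod>k=1..Suc h. \<phi> k) = (\<Prod>k=1..h. \<phi> k) * \<phi> (Suc h)"
    by (simp add: prod.nat_ivl_Suc')
  moreover have "\<phi> (Suc h) \<noteq> 0" using \<phi>(1)[of "Suc h"] assms by simp
  ultimately show ?thesis by (simp add: dual_coeff_def)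
qed

text \<open>The recurrence makes the coordinates of both sides agree for \<open>h < d\<close>. There is no condition left at
  \<open>h = d\<close>, where \<open>c\<^sub>d (\<theta>\<^sup>*\<^sub>j - \<theta>\<^sup>*\<^sub>d)\<close> contains the factor \<open>\<theta>\<^sup>*\<^sub>j - \<theta>\<^sup>*\<^sub>j\<close>.\<close>

lemma As_dual_vec:
  assumes "j \<le> d"
  shows "As (dual_vec j) = \<theta>s j *s dual_vec j"
proof -
  let ?c = "dual_coeff j"
  have last: "?c d * (\<theta>s j - \<theta>s d) = 0"
  proof -
    have "(\<Prod>k<d. \<theta>s j - \<theta>s k) * (\<theta>s j - \<theta>s d) = (\<Prod>k<Suc d. \<theta>s j - \<theta>s k)" by simp
    also have "\<dots> = 0" using assms by (intro prod_zero) auto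
    finally show ?thesis by (simp add: dual_coeff_def)
  qed
  have up: "(\<Sum>h\<in>{1..d}. (?c h * \<phi> h) *s w (h - 1)) = (\<Sum>h\<le>d. (?c h * (\<theta>s j - \<theta>s h)) *s w h)"
  proof -
    have "(\<Sum>h\<in>{1..d}. (?c h * \<phi> h) *s w (h - 1)) = (\<Sum>h<d. (?c (Suc h) * \<phi> (Suc h)) *s w h)"
      by (rule sum.reindex_bij_witness[of _ Suc "\<lambda>h. h - 1"]) auto
    also have "\<dots> = (\<Sum>h<d. (?c h * (\<theta>s j - \<theta>s h)) *s w h)"
      using dual_coeff_Suc by (intro sum.cong) auto
    also have "\<dots> = (\<Sum>h<Suc d. (?c h * (\<theta>s j - \<theta>s h)) *s w h)" using last by simp
    finally show ?thesis by (simp add: lessThan_Suc_atMost)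
  qed
  have "As (dual_vec j) = (\<Sum>h\<le>d. ?c h *s As (w h))"
    unfolding dual_vec_def using w_in by (intro lin_on_comb[OF EndD(1)[OF dual.ebD(4)] frame.ebD(2)])
  also have "\<dots> = (\<Sum>h\<le>d. (?c h * \<theta>s h) *s w h) + (\<Sum>h\<in>{1..d}. (?c h * \<phi> h) *s w (h - 1))"
  proof -
    have "(\<Sum>h\<le>d. ?c h *s As (w h)) = ?c 0 *s As (w 0) + (\<Sum>h\<in>{1..d}. ?c h *s As (w h))"
      by (simp add: sum.atLeast0_atMost_Suc_shift atMost_atLeast0 sum.atLeast_Suc_atMost)
    also have "(\<Sum>h\<in>{1..d}. ?c h *s As (w h)) =
        (\<Sum>h\<in>{1..d}. (?c h * \<theta>s h) *s w h) + (\<Sum>h\<in>{1..d}. (?c h * \<phi> h) *s w (h - 1))"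
      unfolding sum.distrib[symmetric] using \<phi>(2)
      by (intro sum.cong) (simp_all add: scale_right_distrib)
    also have "?c 0 *s As (w 0) + \<dots> =
        (?c 0 * \<theta>s 0) *s w 0 + (\<Sum>h\<in>{1..d}. (?c h * \<theta>s h) *s w h) +
        (\<Sum>h\<in>{1..d}. (?c h * \<phi> h) *s w (h - 1))"
      unfolding As_w0 by simp
    also have "(?c 0 * \<theta>s 0) *s w 0 + (\<Sum>h\<in>{1..d}. (?c h * \<theta>s h) *s w h) =
        (\<Sum>h\<le>d. (?c h * \<theta>s h) *s w h)"
      by (simp add: atMost_atLeast0 sum.atLeast_Suc_atMost)
    finally show ?thesis .
  qed
  also have "\<dots> = (\<Sum>h\<le>d. (?c h * \<theta>s j) *s w h)"
    unfolding up sum.distrib[symmetric] scale_left_distrib[symmetric] by (simp add: algebra_simps)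
  also have "\<dots> = \<theta>s j *s dual_vec j"
    by (simp add: dual_vec_def scale_sum_right mult.commute)
  finally show ?thesis .
qed

lemma dual_eigenbasis: "eigenbasis scale d V As \<theta>s dual_vec"
proof (rule dual.eigenbasis_of_eigenvectors[OF _ _ As_dual_vec])
  show "dual_vec j \<in> V" for j
    unfolding dual_vec_def by (rule basis_seq_comb_in[OF w_basis])
  show "dual_vec j \<noteq> 0" for j
    using basis_seq_eq_0[OF w_basis, of "dual_coeff j" 0] by (auto simp: dual_vec_def dual_coeff_def)
qed

text \<open>The components of \<open>w 0\<close> are the choice of eigenvectors of \<open>A\<close> that makes the first column of the
  transition matrix consist of ones.\<close>

lemma component_eigenbasis: "eigenbasis scale d V A \<theta> (\<lambda>i. E i (w 0))"
proof (rule frame.eigenbasis_of_eigenvectors[OF _ E_w0])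
  show "E i (w 0) \<in> V" if "i \<le> d" for i using frame.E_in[OF that w_in] .
  show "A (E i (w 0)) = \<theta> i *s E i (w 0)" if i: "i \<le> d" for i
  proof -
    obtain c where "E i (w 0) = c *s u i" using frame.E_expand[OF w_in] i by blast
    then show ?thesis
      using EndD(3)[OF frame.ebD(4) frame.ebD(6)[OF i]] frame.ebD(8)[OF i]
      by (simp add: mult.commute)
  qed
qed

text \<open>The projection \<open>E i\<close> turns every \<open>w h\<close> into a known multiple of \<open>E i (w 0)\<close>, and a vector is the
  sum of its projections.\<close>

lemma dual_vec_transition:
  assumes "j \<le> d"
  shows "dual_vec j = (\<Sum>i\<le>d. (\<Sum>h\<le>d. ((\<Prod>k<h. \<theta> i - \<theta> (d - k)) * (\<Prod>k<h. \<theta>s j - \<theta>s k))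
      / (\<Prod>k=1..h. \<phi> k)) *s E i (w 0))"
proof -
  have "dual_vec j = (\<Sum>i\<le>d. E i (dual_vec j))"
    using frame.sum_E[OF eigenbasisD(6)[OF dual_eigenbasis assms]] by simp
  also have "\<dots> = (\<Sum>i\<le>d. (\<Sum>h\<le>d. ((\<Prod>k<h. \<theta> i - \<theta> (d - k)) * (\<Prod>k<h. \<theta>s j - \<theta>s k))
      / (\<Prod>k=1..h. \<phi> k)) *s E i (w 0))"
  proof (rule sum.cong[OF refl])
    fix i assume "i \<in> {..d}"
    then have i: "i \<le> d" by simp
    have "E i (dual_vec j) = (\<Sum>h\<le>d. dual_coeff j h *s E i (w h))"
      unfolding dual_vec_def using w_in
      by (intro lin_on_comb[OF EndD(1)[OF frame.E_End[OF i]] frame.ebD(2)])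
    also have "\<dots> = (\<Sum>h\<le>d. (((\<Prod>k<h. \<theta> i - \<theta> (d - k)) * (\<Prod>k<h. \<theta>s j - \<theta>s k))
      / (\<Prod>k=1..h. \<phi> k)) *s E i (w 0))"
    proof (rule sum.cong[OF refl])
      fix h
      show "dual_coeff j h *s E i (w h) = (((\<Prod>k<h. \<theta> i - \<theta> (d - k)) * (\<Prod>k<h. \<theta>s j - \<theta>s k))
        / (\<Prod>k=1..h. \<phi> k)) *s E i (w 0)"
        using arg_cong[OF E_w[OF i, of h], of "scale (dual_coeff j h)"]
        by (simp add: dual_coeff_def mult.commute del: w.simps)
    qed
    finally show "E i (dual_vec j) = (\<Sum>h\<le>d. ((\<Prod>k<h. \<theta> i - \<theta> (d - k)) * (\<Prod>k<h. \<theta>s j - \<theta>s k))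
      / (\<Prod>k=1..h. \<phi> k)) *s E i (w 0)"
      by (simp add: scale_sum_left del: w.simps)
  qed
  finally show ?thesis .
qed

end

context vector_space
begin

lemma eigenframe_idempotent_frames:
  assumes "eigenframe scale d \<Phi> \<theta> u \<theta>s v"
  shows "idempotent_frame scale d (th_space \<Phi>) (th_A \<Phi>) \<theta> u (\<lambda>i. th_E \<Phi> ! i)"
    "idempotent_frame scale d (th_space \<Phi>) (th_As \<Phi>) \<theta>s v (\<lambda>i. th_Es \<Phi> ! i)"
  using assms vector_space_axioms
  by (simp_all add: eigenframe_def idempotent_frame_def idempotent_frame_axioms_def)

lemma TH_system_eigenbases:
  assumes "\<Phi> \<in> TH_systems scale d"
  obtains \<theta> u \<theta>s v where "eigenframe scale d \<Phi> \<theta> u \<theta>s v"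
    "TH_eigenbases scale d (th_space \<Phi>) (th_A \<Phi>) (th_As \<Phi>) \<theta> \<theta>s u v
      (\<lambda>i. th_E \<Phi> ! i) (\<lambda>i. th_Es \<Phi> ! i)"
proof -
  obtain \<theta> u \<theta>s v where f: "eigenframe scale d \<Phi> \<theta> u \<theta>s v" and c: "\<forall>i\<le>d. \<forall>j\<le>d.
       (i > j + 1 \<longrightarrow> (th_E \<Phi> ! i) (th_As \<Phi> (u j)) = 0 \<and> (th_Es \<Phi> ! i) (th_A \<Phi> (v j)) = 0) \<and>
       (i = j + 1 \<longrightarrow> (th_E \<Phi> ! i) (th_As \<Phi> (u j)) \<noteq> 0 \<and> (th_Es \<Phi> ! i) (th_A \<Phi> (v j)) \<noteq> 0)"
    using assms unfolding TH_systems_iff by blast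
  have "(th_E \<Phi> ! i) (th_As \<Phi> (u j)) = 0" "(th_Es \<Phi> ! i) (th_A \<Phi> (v j)) = 0"
    if "j + 1 < i" "i \<le> d" for i j
    using c[rule_format, of i j] that by auto
  moreover have "(th_E \<Phi> ! Suc j) (th_As \<Phi> (u j)) \<noteq> 0" "(th_Es \<Phi> ! Suc j) (th_A \<Phi> (v j)) \<noteq> 0"
    if "j < d" for j
    using c[rule_format, of "Suc j" j] that by auto
  ultimately have "TH_eigenbases scale d (th_space \<Phi>) (th_A \<Phi>) (th_As \<Phi>) \<theta> \<theta>s u v
      (\<lambda>i. th_E \<Phi> ! i) (\<lambda>i. th_Es \<Phi> ! i)"
    using eigenframe_idempotent_frames[OF f] vector_space_axioms
    by (intro TH_eigenbases.intro TH_eigenbases_axioms.intro)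
  then show ?thesis using that f by blast
qed

text \<open>The normalized eigenbases \<open>E i (w 0)\<close> and \<open>dual_vec j\<close> exhibit \<open>\<Phi>\<close> as one of the systems that arise
  from its own image under \<open>rho_rep\<close>.\<close>

lemma transition_matrix_constructs:
  assumes \<Phi>: "\<Phi> \<in> TH_systems scale d"
  shows "rho_rep scale d \<Phi> \<in> nws_vandermonde d" "constructed_from scale d (rho_rep scale d \<Phi>) \<Phi>"
proof -
  obtain \<theta> u \<theta>s v where f: "eigenframe scale d \<Phi> \<theta> u \<theta>s v" and
    TH: "TH_eigenbases scale d (th_space \<Phi>) (th_A \<Phi>) (th_As \<Phi>) \<theta> \<theta>s u v
      (\<lambda>i. th_E \<Phi> ! i) (\<lambda>i. th_Es \<Phi> ! i)"
    using TH_system_eigenbases[OF \<Phi>] .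
  interpret TH_eigenbases scale d "th_space \<Phi>" "th_A \<Phi>" "th_As \<Phi>" \<theta> \<theta>s u v
      "\<lambda>i. th_E \<Phi> ! i" "\<lambda>i. th_Es \<Phi> ! i" by (rule TH)
  note eig = eigenframe_eig[OF f]
  have split: "split_space d \<Phi> i = range (\<lambda>c. c *s w i)" if "i \<le> d" for i
    unfolding split_space_def dual.flag_eq[OF that] frame.flag_eq[of "d - i", OF diff_le_self]
    by (rule split_component[OF that])
  have phi: "split_eig scale d \<Phi> i = \<phi> i" if i: "1 \<le> i" "i \<le> d" for i
    unfolding split_eig_def split[OF i(2)] eig(2)[OF i(2)]
    using eig(1)[of "d - i + 1"] i split_eigenvalue_unique[OF i] by simp
  define P where "P i j = (\<Sum>h\<le>d. ((\<Prod>k<h. \<theta> i - \<theta> (d - k)) * (\<Prod>k<h. \<theta>s j - \<theta>s k))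
      / (\<Prod>k=1..h. \<phi> k))" for i j
  have P: "(\<Sum>h\<le>d. ((\<Prod>k<h. eig scale \<Phi> i - eig scale \<Phi> (d - k)) *
      (\<Prod>k<h. dual_eig scale \<Phi> j - dual_eig scale \<Phi> k)) / (\<Prod>k=1..h. split_eig scale d \<Phi> k)) = P i j"
    if "i \<le> d" "j \<le> d" for i j
    unfolding P_def using that eig phi
    by (intro sum.cong refl arg_cong2[of _ _ _ _ "(/)"] arg_cong2[of _ _ _ _ "(*)"] prod.cong) auto
  have rho: "rho_rep scale d \<Phi> = (mat (Suc d) (Suc d) (\<lambda>(i, j). P i j),
      map \<theta> [0..<Suc d], map \<theta>s [0..<Suc d])"
    unfolding rho_rep_def transition_matrix_def
    using eig P by (auto simp: less_Suc_eq_le simp del: upt_Suc intro!: eq_matI)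
  show "rho_rep scale d \<Phi> \<in> nws_vandermonde d"
    unfolding rho P_def using \<phi>(1)
    by (intro newton_matrix_vandermonde frame.ebD(5) dual.ebD(5))
  have "\<forall>j\<le>d. dual_vec j = (\<Sum>i\<le>d. mat (Suc d) (Suc d) (\<lambda>(i, j). P i j) $$ (i, j) *s (th_E \<Phi> ! i) (w 0))"
    using dual_vec_transition unfolding P_def by simp
  moreover have "basis_seq scale d (th_space \<Phi>) (\<lambda>i. (th_E \<Phi> ! i) (w 0))"
    "\<forall>i\<le>d. th_A \<Phi> ((th_E \<Phi> ! i) (w 0)) = \<theta> i *s (th_E \<Phi> ! i) (w 0)"
    using eigenbasisD(1,8)[OF component_eigenbasis] by blast+
  moreover have "basis_seq scale d (th_space \<Phi>) dual_vec"
    "\<forall>i\<le>d. th_As \<Phi> (dual_vec i) = \<theta>s i *s dual_vec i"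
    using eigenbasisD(1,8)[OF dual_eigenbasis] by blast+
  ultimately show "constructed_from scale d (rho_rep scale d \<Phi>) \<Phi>"
    unfolding rho constructed_from_def Let_def case_prod_conv
    using f frame.ebD(2,3,4) dual.ebD(4)
    by (intro conjI exI[of _ "\<lambda>i. (th_E \<Phi> ! i) (w 0)"] exI[of _ dual_vec])
      (auto simp: eigenframe_def less_Suc_eq_le simp del: upt_Suc w.simps)
qed

end

section \<open>TH systems constructed from Vandermonde systems\<close>

lemma nws_vandermondeD:
  assumes "(X, \<theta>, \<theta>s) \<in> nws_vandermonde d"
  shows "X \<in> carrier_mat (Suc d) (Suc d)" "length \<theta> = Suc d" "length \<theta>s = Suc d"
    "inj_on (\<lambda>i. \<theta> ! i) {..d}" "inj_on (\<lambda>i. \<theta>s ! i) {..d}"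
    "i \<le> d \<Longrightarrow> X $$ (i, 0) = 1" "j \<le> d \<Longrightarrow> X $$ (d, j) = 1"
proof -
  show "X \<in> carrier_mat (Suc d) (Suc d)" "length \<theta> = Suc d" "length \<theta>s = Suc d"
    "inj_on (\<lambda>i. \<theta> ! i) {..d}" "inj_on (\<lambda>i. \<theta>s ! i) {..d}"
    using assms by (auto simp: nws_vandermonde_def intro!: inj_on_nth)
  obtain f fs where f: "graded d f" "\<forall>i\<le>d. \<forall>j\<le>d. X $$ (i, j) = poly (f j) (\<theta> ! i)"
    and fs: "graded d fs" "\<forall>i\<le>d. \<forall>j\<le>d. X $$ (i, j) = poly (fs (d - i)) (\<theta>s ! j)"
    using assms unfolding nws_vandermonde_def by blast
  show "i \<le> d \<Longrightarrow> X $$ (i, 0) = 1" using f by (simp add: graded_def)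
  show "j \<le> d \<Longrightarrow> X $$ (d, j) = 1" using fs by (simp add: graded_def)
qed

context vector_space
begin

lemma constructed_from_frame:
  assumes w: "(X, \<theta>, \<theta>s) \<in> nws_vandermonde d" and c: "constructed_from scale d (X, \<theta>, \<theta>s) \<Phi>"
  obtains u v where "eigenframe scale d \<Phi> (\<lambda>i. \<theta> ! i) u (\<lambda>i. \<theta>s ! i) v"
    "\<And>j. j \<le> d \<Longrightarrow> v j = (\<Sum>i\<le>d. X $$ (i, j) *s u i)"
proof -
  have inj: "inj_on (\<lambda>i. \<theta> ! i) {..d}" "inj_on (\<lambda>i. \<theta>s ! i) {..d}"
    using w by (auto simp: nws_vandermonde_def intro!: inj_on_nth)
  from c obtain u v where "basis_seq scale d (th_space \<Phi>) u" "basis_seq scale d (th_space \<Phi>) v"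
    "\<forall>j\<le>d. v j = (\<Sum>i\<le>d. X $$ (i, j) *s u i)"
    "\<forall>i\<le>d. th_A \<Phi> (u i) = \<theta> ! i *s u i" "\<forall>i\<le>d. th_As \<Phi> (v i) = \<theta>s ! i *s v i"
    unfolding constructed_from_def Let_def case_prod_conv by blast
  then show ?thesis
    using that[of u v] inj c
    unfolding constructed_from_def Let_def case_prod_conv eigenframe_def eigenbasis_def by blast
qed

text \<open>In coordinates with respect to \<open>u\<close>, the expansion \<open>A v\<^sub>j = \<Sum>\<^sub>i c\<^sub>i v\<^sub>i\<close> is a recurrence for the first
  graded sequence. For \<open>A\<^sup>*\<close>, evaluating \<open>A\<^sup>* v\<^sub>k\<close> in two ways gives
  \<open>\<Sum>\<^sub>j B\<^bsub>ji\<^esub> X\<^bsub>jk\<^esub> = \<theta>\<^sup>*\<^sub>k X\<^bsub>ik\<^esub>\<close>, where \<open>B\<^bsub>ji\<^esub>\<close> is the \<open>u\<^sub>i\<close>-coordinate of \<open>A\<^sup>* u\<^sub>j\<close>. This is a recurrence for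
  the second graded sequence after the substitution \<open>m = d - j\<close>.\<close>

lemma constructed_from_TH_system:
  assumes w: "(X, \<theta>, \<theta>s) \<in> nws_vandermonde d" and c: "constructed_from scale d (X, \<theta>, \<theta>s) \<Phi>"
  shows "\<Phi> \<in> TH_systems scale d"
proof -
  obtain u v where f: "eigenframe scale d \<Phi> (\<lambda>i. \<theta> ! i) u (\<lambda>i. \<theta>s ! i) v" and
    v: "\<And>j. j \<le> d \<Longrightarrow> v j = (\<Sum>i\<le>d. X $$ (i, j) *s u i)"
    using constructed_from_frame[OF w c] by blast
  obtain g where g: "graded d g" "\<And>i j. i \<le> d \<Longrightarrow> j \<le> d \<Longrightarrow> X $$ (i, j) = poly (g j) (\<theta> ! i)"
    using w unfolding nws_vandermonde_def by blast
  obtain gs where gs: "graded d gs" "\<And>i j. i \<le> d \<Longrightarrow> j \<le> d \<Longrightarrow> X $$ (i, j) = poly (gs (d - i)) (\<theta>s ! j)"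
    using w unfolding nws_vandermonde_def by blast
  interpret frame: idempotent_frame scale d "th_space \<Phi>" "th_A \<Phi>" "\<lambda>i. \<theta> ! i" u "\<lambda>i. th_E \<Phi> ! i"
    by (rule eigenframe_idempotent_frames(1)[OF f])
  interpret dual: idempotent_frame scale d "th_space \<Phi>" "th_As \<Phi>" "\<lambda>i. \<theta>s ! i" v "\<lambda>i. th_Es \<Phi> ! i"
    by (rule eigenframe_idempotent_frames(2)[OF f])
  have A: "(j + 1 < i \<longrightarrow> (th_Es \<Phi> ! i) (th_A \<Phi> (v j)) = 0) \<and>
      (i = j + 1 \<longrightarrow> (th_Es \<Phi> ! i) (th_A \<Phi> (v j)) \<noteq> 0)" if i: "i \<le> d" and j: "j < d" for i j
  proof -
    obtain c where c: "th_A \<Phi> (v j) = (\<Sum>i\<le>d. c i *s v i)"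
      "\<And>i. i \<le> d \<Longrightarrow> (th_Es \<Phi> ! i) (th_A \<Phi> (v j)) = c i *s v i"
      using dual.E_expand[OF EndD(2)[OF frame.ebD(4) dual.ebD(6)]] j less_imp_le by metis
    have "(\<Sum>i\<le>d. c i * poly (g i) (\<theta> ! k)) = \<theta> ! k * poly (g j) (\<theta> ! k)" if k: "k \<le> d" for k
    proof -
      have "th_A \<Phi> (v j) = (\<Sum>k\<le>d. X $$ (k, j) *s th_A \<Phi> (u k))"
        using v[of j] j frame.ebD(6) lin_on_comb[OF EndD(1)[OF frame.ebD(4)] frame.ebD(2),
            of "{..d}" u "\<lambda>k. X $$ (k, j)"] by simp
      then have "th_A \<Phi> (v j) = (\<Sum>k\<le>d. (X $$ (k, j) * \<theta> ! k) *s u k)"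
        using frame.ebD(8) by simp
      moreover have "(\<Sum>i\<le>d. c i *s v i) = (\<Sum>i\<le>d. \<Sum>k\<le>d. (c i * X $$ (k, i)) *s u k)"
        using v by (intro sum.cong) (auto simp: scale_sum_right)
      then have "th_A \<Phi> (v j) = (\<Sum>k\<le>d. (\<Sum>i\<le>d. c i * X $$ (k, i)) *s u k)"
        unfolding c(1) by (subst (asm) sum.swap) (simp add: scale_sum_left)
      ultimately have "(\<Sum>i\<le>d. c i * X $$ (k, i)) = X $$ (k, j) * \<theta> ! k"
        using basis_seq_eqD[OF frame.ebD(1) _ k, of "\<lambda>k. \<Sum>i\<le>d. c i * X $$ (k, i)"
          "\<lambda>k. X $$ (k, j) * \<theta> ! k"] by simp
      then show ?thesis using g(2)[OF k] j by (simp add: mult.commute)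
    qed
    from graded_recurrence[OF g(1) frame.ebD(5) j this]
    have "c (Suc j) \<noteq> 0" "j + 1 < i \<Longrightarrow> c i = 0" using i by auto
    then show ?thesis using c(2)[OF i] dual.ebD(7)[OF i] by auto
  qed
  have "\<forall>j\<in>{..d}. \<exists>b. th_As \<Phi> (u j) = (\<Sum>i\<le>d. b i *s u i)"
    using basis_seq_expand[OF frame.ebD(1) EndD(2)[OF dual.ebD(4) frame.ebD(6)]] by simp
  then obtain B where B: "\<And>j. j \<le> d \<Longrightarrow> th_As \<Phi> (u j) = (\<Sum>i\<le>d. B j i *s u i)"
    by (metis atMost_iff)
  have As: "(j + 1 < i \<longrightarrow> (th_E \<Phi> ! i) (th_As \<Phi> (u j)) = 0) \<and>
      (i = j + 1 \<longrightarrow> (th_E \<Phi> ! i) (th_As \<Phi> (u j)) \<noteq> 0)"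
    if i: "0 < i" "i \<le> d" and j: "j \<le> d" for i j
  proof -
    have "(\<Sum>m\<le>d. B (d - m) i * poly (gs m) (\<theta>s ! k)) = \<theta>s ! k * poly (gs (d - i)) (\<theta>s ! k)"
      if k: "k \<le> d" for k
    proof -
      have "th_As \<Phi> (v k) = (\<Sum>j\<le>d. X $$ (j, k) *s th_As \<Phi> (u j))"
        using v[OF k] frame.ebD(6) lin_on_comb[OF EndD(1)[OF dual.ebD(4)] frame.ebD(2),
            of "{..d}" u "\<lambda>j. X $$ (j, k)"] by simp
      also have "\<dots> = (\<Sum>j\<le>d. \<Sum>i\<le>d. (X $$ (j, k) * B j i) *s u i)"
        using B by (intro sum.cong) (auto simp: scale_sum_right)
      also have "\<dots> = (\<Sum>i\<le>d. (\<Sum>j\<le>d. X $$ (j, k) * B j i) *s u i)"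
        by (subst sum.swap) (simp add: scale_sum_left)
      finally have "th_As \<Phi> (v k) = (\<Sum>i\<le>d. (\<Sum>j\<le>d. X $$ (j, k) * B j i) *s u i)" .
      moreover have "th_As \<Phi> (v k) = (\<Sum>i\<le>d. (\<theta>s ! k * X $$ (i, k)) *s u i)"
        using dual.ebD(8)[OF k] v[OF k] by (simp add: scale_sum_right)
      ultimately have "(\<Sum>j\<le>d. X $$ (j, k) * B j i) = \<theta>s ! k * X $$ (i, k)"
        using basis_seq_eqD[OF frame.ebD(1) _ i(2), of "\<lambda>i. \<Sum>j\<le>d. X $$ (j, k) * B j i"
          "\<lambda>i. \<theta>s ! k * X $$ (i, k)"] by simp
      moreover have "(\<Sum>j\<le>d. X $$ (j, k) * B j i) = (\<Sum>m\<le>d. B (d - m) i * poly (gs m) (\<theta>s ! k))"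
        using gs(2)[OF _ k]
        by (intro sum.reindex_bij_witness[of _ "\<lambda>m. d - m" "\<lambda>j. d - j"]) auto
      ultimately show ?thesis using gs(2)[OF i(2) k] by simp
    qed
    note rec = graded_recurrence[OF gs(1) dual.ebD(5) _ this]
    have "j + 1 < i \<Longrightarrow> B j i = 0" "i = j + 1 \<Longrightarrow> B j i \<noteq> 0"
      using rec(1) rec(2)[of "d - j"] i j by auto
    moreover have "(th_E \<Phi> ! i) (th_As \<Phi> (u j)) = B j i *s u i"
      unfolding B[OF j] by (rule frame.E_comb[OF i(2)])
    ultimately show ?thesis using i j frame.ebD(7)[OF i(2)] by auto
  qed
  have "(i > j + 1 \<longrightarrow> (th_E \<Phi> ! i) (th_As \<Phi> (u j)) = 0 \<and> (th_Es \<Phi> ! i) (th_A \<Phi> (v j)) = 0) \<and>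
      (i = j + 1 \<longrightarrow> (th_E \<Phi> ! i) (th_As \<Phi> (u j)) \<noteq> 0 \<and> (th_Es \<Phi> ! i) (th_A \<Phi> (v j)) \<noteq> 0)"
    if "i \<le> d" "j \<le> d" for i j
  proof (cases "j < i")
    case True
    then show ?thesis using A[of i j] As[of i j] that by simp
  qed simp
  then show ?thesis unfolding TH_systems_iff using f by blast
qed

text \<open>The image of \<open>E i\<close> is a line that contains both vectors.\<close>

lemma idempotent_frame_rescaling:
  assumes "idempotent_frame scale d V A \<theta> u E" "idempotent_frame scale d V A \<theta> u' E" "i \<le> d"
  shows "\<exists>c. u' i = c *s u i \<and> c \<noteq> 0"
proof -
  interpret f: idempotent_frame scale d V A \<theta> u E by fact
  interpret g: idempotent_frame scale d V A \<theta> u' E by fact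
  obtain c where c: "E i (u' i) = c *s u i"
    using f.E_expand[OF g.ebD(6)[OF assms(3)]] assms(3) by blast
  then have "u' i = c *s u i" using g.E_u[OF assms(3,3)] by simp
  moreover have "c \<noteq> 0" using \<open>u' i = c *s u i\<close> g.ebD(7)[OF assms(3)] by auto
  ultimately show ?thesis by blast
qed

text \<open>Two eigenbases for the same ordered idempotents differ by nonzero scalars \<open>a\<^sub>i\<close> and \<open>b\<^sub>j\<close>, so
  \<open>b\<^sub>j X\<^bsub>ij\<^esub> = X'\<^bsub>ij\<^esub> a\<^sub>i\<close>. Column \<open>0\<close> of ones forces \<open>a\<^sub>i = b\<^sub>0\<close> for all \<open>i\<close>, and row \<open>d\<close> of ones forces
  \<open>b\<^sub>j = a\<^sub>d\<close> for all \<open>j\<close>.\<close>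

lemma constructed_from_unique:
  assumes w: "w \<in> nws_vandermonde d" "constructed_from scale d w \<Phi>"
    and w': "w' \<in> nws_vandermonde d" "constructed_from scale d w' \<Phi>"
  shows "w = w'"
proof -
  obtain X \<theta> \<theta>s where w_eq: "w = (X, \<theta>, \<theta>s)" by (cases w)
  obtain X' \<theta>' \<theta>s' where w'_eq: "w' = (X', \<theta>', \<theta>s')" by (cases w')
  note N = nws_vandermondeD[OF w(1)[unfolded w_eq]]
  note N' = nws_vandermondeD[OF w'(1)[unfolded w'_eq]]
  obtain u v where f: "eigenframe scale d \<Phi> (\<lambda>i. \<theta> ! i) u (\<lambda>i. \<theta>s ! i) v" and
    v: "\<And>j. j \<le> d \<Longrightarrow> v j = (\<Sum>i\<le>d. X $$ (i, j) *s u i)"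
    using constructed_from_frame[OF w[unfolded w_eq]] by blast
  obtain u' v' where f': "eigenframe scale d \<Phi> (\<lambda>i. \<theta>' ! i) u' (\<lambda>i. \<theta>s' ! i) v'" and
    v': "\<And>j. j \<le> d \<Longrightarrow> v' j = (\<Sum>i\<le>d. X' $$ (i, j) *s u' i)"
    using constructed_from_frame[OF w'[unfolded w'_eq]] by blast
  have \<theta>: "\<theta> = \<theta>'" "\<theta>s = \<theta>s'"
    using N(2,3) N'(2,3) eigenframe_eig[OF f] eigenframe_eig[OF f']
    by (auto intro!: nth_equalityI simp: less_Suc_eq_le)
  note F = eigenframe_idempotent_frames[OF f]
  note F' = eigenframe_idempotent_frames[OF f', folded \<theta>]
  obtain a where a: "\<And>i. i \<le> d \<Longrightarrow> u' i = a i *s u i \<and> a i \<noteq> 0"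
    using idempotent_frame_rescaling[OF F(1) F'(1)] by metis
  obtain b where b: "\<And>j. j \<le> d \<Longrightarrow> v' j = b j *s v j \<and> b j \<noteq> 0"
    using idempotent_frame_rescaling[OF F(2) F'(2)] by metis
  have eq: "b j * X $$ (i, j) = X' $$ (i, j) * a i" if "i \<le> d" "j \<le> d" for i j
  proof -
    have "(\<Sum>i\<le>d. (b j * X $$ (i, j)) *s u i) = v' j"
      using b[OF that(2)] v[OF that(2)] by (simp add: scale_sum_right)
    also have "\<dots> = (\<Sum>i\<le>d. (X' $$ (i, j) * a i) *s u i)"
      using v'[OF that(2)] a by simp
    finally show ?thesis
      using basis_seq_eqD[OF idempotent_frame.ebD(1)[OF F(1)] _ that(1),
        of "\<lambda>i. b j * X $$ (i, j)" "\<lambda>i. X' $$ (i, j) * a i"] by simp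
  qed
  have a0: "a i = b 0" if "i \<le> d" for i using eq[OF that, of 0] N(6) N'(6) that by simp
  have bd: "b j = a d" if "j \<le> d" for j using eq[OF _ that, of d] N(7) N'(7) that by simp
  have "X $$ (i, j) = X' $$ (i, j)" if "i \<le> d" "j \<le> d" for i j
    using eq[OF that] a0[OF that(1)] bd[OF that(2)] a0[of d] b[of 0] by simp
  then have "X = X'" using N(1) N'(1) by (intro eq_matI) auto
  then show ?thesis by (simp add: w_eq w'_eq \<theta>)
qed

lemma constructed_from_rho_rep:
  assumes "w \<in> nws_vandermonde d" "constructed_from scale d w \<Phi>"
  shows "\<Phi> \<in> TH_systems scale d" "rho_rep scale d \<Phi> = w"
proof -
  show TH: "\<Phi> \<in> TH_systems scale d"
    using assms constructed_from_TH_system by (cases w) blast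
  show "rho_rep scale d \<Phi> = w"
    by (rule constructed_from_unique[OF transition_matrix_constructs[OF TH] assms])
qed

text \<open>A relation between the columns of \<open>X\<close> is a combination of the graded sequence that vanishes at
  \<open>d + 1\<close> distinct points. So \<open>X\<close> is invertible, and the vectors \<open>v\<^sub>j\<close> defined by it form a basis.\<close>

lemma constructed_from_exists:
  assumes V: "subspace V" "dim V = Suc d" and w: "(X, \<theta>, \<theta>s) \<in> nws_vandermonde d"
  shows "\<exists>\<Phi>. constructed_from scale d (X, \<theta>, \<theta>s) \<Phi>"
proof -
  note N = nws_vandermondeD[OF w]
  obtain f where f: "graded d f" "\<And>i j. i \<le> d \<Longrightarrow> j \<le> d \<Longrightarrow> X $$ (i, j) = poly (f j) (\<theta> ! i)"
    using w unfolding nws_vandermonde_def by blast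
  obtain u where u: "basis_seq scale d V u" using subspace_has_basis_seq[OF V] by blast
  define v where "v j = (\<Sum>i\<le>d. X $$ (i, j) *s u i)" for j
  have v: "basis_seq scale d V v"
  proof (rule independent_basis_seq[OF V])
    show "v j \<in> V" for j unfolding v_def by (rule basis_seq_comb_in[OF u])
    fix c j assume c: "(\<Sum>j\<le>d. c j *s v j) = 0" and j: "j \<le> d"
    have "(\<Sum>j\<le>d. c j *s v j) = (\<Sum>i\<le>d. (\<Sum>j\<le>d. c j * X $$ (i, j)) *s u i)"
      unfolding v_def scale_sum_right by (subst sum.swap) (simp add: scale_sum_left)
    then have X: "(\<Sum>j\<le>d. c j * X $$ (i, j)) = 0" if "i \<le> d" for i
      using basis_seq_eq_0[OF u _ that, of "\<lambda>i. \<Sum>j\<le>d. c j * X $$ (i, j)"] c by simp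
    have "(\<Sum>j\<le>d. c j * poly (f j) (\<theta> ! i)) = 0" if "i \<le> d" for i
      using X[OF that] f(2)[OF that] by simp
    from graded_values_independent[OF f(1) N(4) this j] show "c j = 0" by simp
  qed
  have y: "\<forall>i\<le>d. \<theta> ! i *s u i \<in> V" "\<forall>i\<le>d. \<theta>s ! i *s v i \<in> V"
    using subspace_scale[OF V(1)] basis_seq_in[OF u] basis_seq_in[OF v] by auto
  obtain A where A: "A \<in> End scale V" "\<forall>i\<le>d. A (u i) = \<theta> ! i *s u i"
    using End_extend[OF u y(1)] ..
  obtain As where As: "As \<in> End scale V" "\<forall>i\<le>d. As (v i) = \<theta>s ! i *s v i"
    using End_extend[OF v y(2)] ..
  have e: "eigenbasis scale d V A (\<lambda>i. \<theta> ! i) u" "eigenbasis scale d V As (\<lambda>i. \<theta>s ! i) v"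
    using u v A As N(4,5) by (simp_all add: eigenbasis_def)
  obtain E where E: "\<And>i. i \<le> d \<Longrightarrow> primitive_idempotent scale V A (\<theta> ! i) (E i)"
    using primitive_idempotent_exists[OF e(1)] by metis
  obtain Es where Es: "\<And>i. i \<le> d \<Longrightarrow> primitive_idempotent scale V As (\<theta>s ! i) (Es i)"
    using primitive_idempotent_exists[OF e(2)] by metis
  let ?\<Phi> = "\<lparr>th_space = V, th_A = A, th_E = map E [0..<Suc d], th_As = As, th_Es = map Es [0..<Suc d]\<rparr>"
  have "constructed_from scale d (X, \<theta>, \<theta>s) ?\<Phi>"
    unfolding constructed_from_def Let_def case_prod_conv
    using V u v A As E Es
    by (intro conjI exI[of _ u] exI[of _ v]) (auto simp: v_def less_Suc_eq_le simp del: upt_Suc)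
  then show ?thesis by blast
qed

end

section \<open>Isomorphism classes\<close>

context vector_space
begin

lemma lin_on_basis_seq:
  assumes u: "basis_seq scale d V u" and S: "lin_on scale V W S" "bij_betw S V W"
    and W: "subspace W" "dim W = Suc d"
  shows "basis_seq scale d W (\<lambda>i. S (u i))"
proof (rule independent_basis_seq[OF W])
  note V = basis_seq_subspace[OF u]
  show "i \<le> d \<Longrightarrow> S (u i) \<in> W" for i using lin_on_in[OF S(1)] basis_seq_in[OF u] by blast
  fix c i assume c: "(\<Sum>i\<le>d. c i *s S (u i)) = 0" and i: "i \<le> d"
  have "S (\<Sum>i\<le>d. c i *s u i) = S 0"
    using c lin_on_comb[OF S(1) V, of "{..d}" u c] basis_seq_in[OF u] lin_on_0[OF S(1) V] by simp
  then have "(\<Sum>i\<le>d. c i *s u i) = 0"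
    using S(2) basis_seq_comb_in[OF u] subspace_0[OF V] by (auto simp: bij_betw_def inj_on_eq_iff)
  then show "c i = 0" by (rule basis_seq_eq_0[OF u _ i])
qed

text \<open>Let \<open>m x\<close> be the endomorphism that sends \<open>u 0\<close> to \<open>x\<close> and the other \<open>u i\<close> to \<open>0\<close>, so that
  \<open>f \<circ> m x = m (f x)\<close>. For a fixed vector \<open>w0\<close> of \<open>W\<close>, the map \<open>S x = \<gamma> (m x) w0\<close> is linear, and
  applying \<open>\<gamma>\<close> to this identity gives \<open>\<gamma> f (S x) = S (f x)\<close>. By transitivity of \<open>End\<close> on nonzero
  vectors, \<open>S\<close> is bijective as soon as \<open>S (u 0) \<noteq> 0\<close>.\<close>

lemma algebra_iso_conjugation:
  assumes V: "subspace V" "dim V = Suc d" and W: "subspace W" "dim W = Suc d"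
    and \<gamma>: "algebra_iso scale V W \<gamma>"
  obtains S where "lin_on scale V W S" "bij_betw S V W"
    "\<And>f x. f \<in> End scale V \<Longrightarrow> x \<in> V \<Longrightarrow> \<gamma> f (S x) = S (f x)"
proof -
  obtain u where u: "basis_seq scale d V u" using subspace_has_basis_seq[OF V] by blast
  obtain u' where u': "basis_seq scale d W u'" using subspace_has_basis_seq[OF W] by blast
  note uV = basis_seq_in[OF u]
  have bij: "bij_betw \<gamma> (End scale V) (End scale W)"
    and add: "\<And>f g. f \<in> End scale V \<Longrightarrow> g \<in> End scale V \<Longrightarrow> \<gamma> (\<lambda>x\<in>V. f x + g x) = (\<lambda>x\<in>W. \<gamma> f x + \<gamma> g x)"
    and scl: "\<And>c f. f \<in> End scale V \<Longrightarrow> \<gamma> (\<lambda>x\<in>V. c *s f x) = (\<lambda>x\<in>W. c *s \<gamma> f x)"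
    and comp: "\<And>f g. f \<in> End scale V \<Longrightarrow> g \<in> End scale V \<Longrightarrow> \<gamma> (compose V f g) = compose W (\<gamma> f) (\<gamma> g)"
    using \<gamma> by (auto simp: algebra_iso_def)
  have \<gamma>_End: "\<gamma> f \<in> End scale W" if "f \<in> End scale V" for f
    using bij_betwE[OF bij] that by blast
  have "\<exists>f\<in>End scale V. \<forall>i\<le>d. f (u i) = (if i = 0 then x else 0)" if "x \<in> V" for x
    using that subspace_0[OF V(1)] by (intro End_extend[OF u]) auto
  then obtain m where m: "\<And>x. x \<in> V \<Longrightarrow> m x \<in> End scale V"
    "\<And>x i. x \<in> V \<Longrightarrow> i \<le> d \<Longrightarrow> m x (u i) = (if i = 0 then x else 0)"
    by metis
  have m_End: "m (f x) = compose V f (m x)" if "f \<in> End scale V" "x \<in> V" for f x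
    using that m EndD(2)[OF that] uV lin_on_0[OF EndD(1)[OF that(1)] V(1)]
    by (intro End_eqI[OF u m(1) compose_End[OF V(1) that(1) m(1)]]) (auto simp: compose_def)
  have m_add: "m (x + y) = (\<lambda>z\<in>V. m x z + m y z)" if xy: "x \<in> V" "y \<in> V" for x y
  proof (rule End_eqI[OF u m(1)[OF subspace_add[OF V(1) xy]]])
    show "(\<lambda>z\<in>V. m x z + m y z) \<in> End scale V"
      using m(1)[OF xy(1)] m(1)[OF xy(2)] subspace_add[OF V(1)] subspace_scale[OF V(1)]
      by (auto simp: End_iff lin_on_def Pi_iff algebra_simps scale_right_distrib)
    show "i \<le> d \<Longrightarrow> m (x + y) (u i) = (\<lambda>z\<in>V. m x z + m y z) (u i)" for i
      using m(2) xy subspace_add[OF V(1) xy] uV by simp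
  qed
  have m_scale: "m (c *s x) = (\<lambda>z\<in>V. c *s m x z)" if x: "x \<in> V" for c x
  proof (rule End_eqI[OF u m(1)[OF subspace_scale[OF V(1) x]]])
    show "(\<lambda>z\<in>V. c *s m x z) \<in> End scale V"
      using m(1)[OF x] subspace_add[OF V(1)] subspace_scale[OF V(1)]
      by (auto simp: End_iff lin_on_def Pi_iff scale_right_distrib mult.commute)
    show "i \<le> d \<Longrightarrow> m (c *s x) (u i) = (\<lambda>z\<in>V. c *s m x z) (u i)" for i
      using m(2) x subspace_scale[OF V(1) x] uV by simp
  qed
  \<comment> \<open>The projection \<open>?e\<close> to the line of \<open>u 0\<close> has a nonzero idempotent as its image under \<open>\<gamma>\<close>, and \<open>w0\<close> is
    taken from the range of the latter. This ensures \<open>S (u 0) = w0 \<noteq> 0\<close>.\<close>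
  let ?e = "m (u 0)"
  have e: "?e \<in> End scale V" "?e (u 0) = u 0" using m(1)[OF uV, of 0] m(2)[OF uV, of 0 0] by simp_all
  have "\<exists>y\<in>W. \<gamma> ?e y \<noteq> 0"
  proof (rule ccontr)
    assume "\<not> ?thesis"
    then have "\<gamma> ?e = (\<lambda>x\<in>W. 0 *s \<gamma> ?e x)"
      using EndD(5)[OF \<gamma>_End[OF e(1)]] by (intro extensionalityI[of _ W]) auto
    then have "\<gamma> ?e = \<gamma> (m (0 *s u 0))"
      unfolding m_scale[OF uV[of 0, simplified]] using scl[OF e(1), of 0] by simp
    moreover have "m (0 *s u 0) \<in> End scale V"
      using m(1)[OF subspace_0[OF V(1)]] by simp
    ultimately have "?e = m (0 *s u 0)" using e(1) bij by (auto simp: bij_betw_def dest: inj_onD)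
    then have "u 0 = m (0 *s u 0) (u 0)" using e(2) by simp
    also have "\<dots> = 0" using m(2)[OF subspace_0[OF V(1)], of 0] by simp
    finally show False using basis_seq_nonzero[OF u, of 0] by simp
  qed
  then obtain y0 where y0: "y0 \<in> W" "\<gamma> ?e y0 \<noteq> 0" by blast
  define w0 where "w0 = \<gamma> ?e y0"
  have w0: "w0 \<in> W" "w0 \<noteq> 0" "\<gamma> ?e w0 = w0"
  proof -
    show "w0 \<in> W" "w0 \<noteq> 0" using y0 EndD(2)[OF \<gamma>_End[OF e(1)]] by (simp_all add: w0_def)
    have "?e = compose V ?e ?e" using m_End[OF e(1) uV[of 0]] e(2) by simp
    then have "\<gamma> ?e = compose W (\<gamma> ?e) (\<gamma> ?e)" using comp[OF e(1) e(1)] by simp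
    then show "\<gamma> ?e w0 = w0" using y0(1) unfolding w0_def by (metis compose_eq)
  qed
  define S where "S x = \<gamma> (m x) w0" for x
  have S: "lin_on scale V W S"
    unfolding lin_on_def S_def
    using EndD(2)[OF \<gamma>_End[OF m(1)] w0(1)] add[OF m(1) m(1)] scl[OF m(1)] w0(1)
    by (simp add: m_add m_scale Pi_iff)
  have S_\<gamma>: "\<gamma> f (S x) = S (f x)" if "f \<in> End scale V" "x \<in> V" for f x
    unfolding S_def m_End[OF that] comp[OF that(1) m(1)[OF that(2)]]
    using w0(1) by (simp add: compose_eq)
  have S0: "S (u 0) = w0" by (simp add: S_def w0(3))
  have "bij_betw S V W" unfolding bij_betw_def
  proof (intro conjI inj_onI equalityI subsetI)
    fix x y assume xy: "x \<in> V" "y \<in> V" "S x = S y"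
    show "x = y"
    proof (rule ccontr)
      assume "x \<noteq> y"
      then obtain g where g: "g \<in> End scale V" "g (x - y) = u 0"
        using End_transitive[OF u subspace_diff[OF V(1) xy(1,2)] _ uV[of 0]] by auto
      have "S (x - y) = 0" using lin_on_diff[OF S V(1) xy(1,2)] xy(3) by simp
      then have "w0 = \<gamma> g 0"
        using S_\<gamma>[OF g(1) subspace_diff[OF V(1) xy(1,2)]] g(2) S0 by simp
      then show False using w0(2) lin_on_0[OF EndD(1)[OF \<gamma>_End[OF g(1)]] W(1)] by simp
    qed
  next
    show "y \<in> S ` V \<Longrightarrow> y \<in> W" for y using lin_on_in[OF S] by blast
    fix y assume "y \<in> W"
    then obtain h where h: "h \<in> End scale W" "h w0 = y"
      using End_transitive[OF u' w0(1,2)] by blast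
    then obtain f where f: "f \<in> End scale V" "h = \<gamma> f"
      using bij by (auto simp: bij_betw_def)
    then have "y = S (f (u 0))" using S_\<gamma>[OF f(1) uV[of 0]] h(2) S0 by simp
    then show "y \<in> S ` V" using EndD(2)[OF f(1) uV[of 0]] by blast
  qed
  then show ?thesis using that S S_\<gamma> by blast
qed

lemma primitive_idempotent_transport:
  assumes e: "eigenbasis scale d V A \<theta> u" and i: "i \<le> d" and P: "primitive_idempotent scale V A (\<theta> i) P"
    and e': "eigenbasis scale d W B \<theta> (\<lambda>i. S (u i))" and Q: "Q \<in> End scale W"
    and S: "lin_on scale V W S" and QS: "\<And>x. x \<in> V \<Longrightarrow> Q (S x) = S (P x)"
  shows "primitive_idempotent scale W B (\<theta> i) Q"
  using P Q QS eigenbasisD(6)[OF e] lin_on_0[OF S eigenbasisD(2)[OF e]]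
  unfolding primitive_idempotent_iff[OF e i] primitive_idempotent_iff[OF e' i] by simp

lemma TH_systemsD:
  assumes "\<Phi> \<in> TH_systems scale d"
  shows "subspace (th_space \<Phi>)" "dim (th_space \<Phi>) = Suc d" "length (th_E \<Phi>) = Suc d"
    "length (th_Es \<Phi>) = Suc d"
  using assms by (simp_all add: TH_systems_def Let_def)

text \<open>The bijection \<open>S\<close> carries eigenbases of \<open>\<Phi>\<close> to eigenbases of \<open>\<Psi>\<close> with the same transition matrix,
  so \<open>\<Psi>\<close> arises from \<open>rho_rep scale d \<Phi>\<close> and the uniqueness of the matrix applies.\<close>

lemma TH_iso_rho_rep_eq:
  assumes "(\<Phi>, \<Psi>) \<in> TH_iso scale d"
  shows "rho_rep scale d \<Phi> = rho_rep scale d \<Psi>"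
proof -
  let ?V = "th_space \<Phi>" and ?W = "th_space \<Psi>"
  have TH: "\<Phi> \<in> TH_systems scale d" "\<Psi> \<in> TH_systems scale d" using assms by (auto simp: TH_iso_def)
  obtain \<gamma> where \<gamma>: "algebra_iso scale ?V ?W \<gamma>" "th_A \<Psi> = \<gamma> (th_A \<Phi>)" "th_As \<Psi> = \<gamma> (th_As \<Phi>)"
    "\<And>i. i \<le> d \<Longrightarrow> th_E \<Psi> ! i = \<gamma> (th_E \<Phi> ! i) \<and> th_Es \<Psi> ! i = \<gamma> (th_Es \<Phi> ! i)"
    using assms unfolding TH_iso_def by blast
  note D = TH_systemsD[OF TH(1)] and D' = TH_systemsD[OF TH(2)]
  obtain S where S: "lin_on scale ?V ?W S" "bij_betw S ?V ?W"
    "\<And>f x. f \<in> End scale ?V \<Longrightarrow> x \<in> ?V \<Longrightarrow> \<gamma> f (S x) = S (f x)"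
    using algebra_iso_conjugation[OF D(1,2) D'(1,2) \<gamma>(1)] by blast
  have \<gamma>_End: "\<gamma> f \<in> End scale ?W" if "f \<in> End scale ?V" for f
    using \<gamma>(1) that by (auto simp: algebra_iso_def bij_betw_def)
  obtain X \<theta> \<theta>s where rho: "rho_rep scale d \<Phi> = (X, \<theta>, \<theta>s)" by (cases "rho_rep scale d \<Phi>")
  note T = transition_matrix_constructs[OF TH(1), unfolded rho]
  obtain u v where f: "eigenframe scale d \<Phi> (\<lambda>i. \<theta> ! i) u (\<lambda>i. \<theta>s ! i) v" and
    v: "\<And>j. j \<le> d \<Longrightarrow> v j = (\<Sum>i\<le>d. X $$ (i, j) *s u i)"
    using constructed_from_frame[OF T] by blast
  have e: "eigenbasis scale d ?V (th_A \<Phi>) (\<lambda>i. \<theta> ! i) u" "eigenbasis scale d ?V (th_As \<Phi>) (\<lambda>i. \<theta>s ! i) v"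
    using f by (simp_all add: eigenframe_def)
  note U = eigenbasisD[OF e(1)] and U' = eigenbasisD[OF e(2)]
  have E: "primitive_idempotent scale ?V (th_A \<Phi>) (\<theta> ! i) (th_E \<Phi> ! i)"
    "primitive_idempotent scale ?V (th_As \<Phi>) (\<theta>s ! i) (th_Es \<Phi> ! i)" if "i \<le> d" for i
    using f that by (simp_all add: eigenframe_def)
  have E_End: "th_E \<Phi> ! i \<in> End scale ?V" "th_Es \<Phi> ! i \<in> End scale ?V" if "i \<le> d" for i
    using E[OF that] by (simp_all add: primitive_idempotent_def)
  have e': "eigenbasis scale d ?W (th_A \<Psi>) (\<lambda>i. \<theta> ! i) (\<lambda>i. S (u i))"
    "eigenbasis scale d ?W (th_As \<Psi>) (\<lambda>i. \<theta>s ! i) (\<lambda>i. S (v i))"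
    unfolding eigenbasis_def
    using lin_on_basis_seq[OF U(1) S(1,2) D'(1,2)] lin_on_basis_seq[OF U'(1) S(1,2) D'(1,2)]
      \<gamma>_End[OF U(4)] \<gamma>_End[OF U'(4)] U(5) U'(5) S(3)[OF U(4)] S(3)[OF U'(4)] U(6,8) U'(6,8)
      lin_on_scale[OF S(1)]
    by (simp_all add: \<gamma>(2,3))
  have "S (v j) = (\<Sum>i\<le>d. X $$ (i, j) *s S (u i))" if "j \<le> d" for j
    using lin_on_comb[OF S(1) D(1), of "{..d}" u "\<lambda>i. X $$ (i, j)"] U(6) v[OF that] by simp
  moreover have "primitive_idempotent scale ?W (th_A \<Psi>) (\<theta> ! i) (th_E \<Psi> ! i)" if i: "i \<le> d" for i
    using primitive_idempotent_transport[OF e(1) i E(1)[OF i] e'(1) \<gamma>_End[OF E_End(1)[OF i]] S(1)]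
      S(3)[OF E_End(1)[OF i]] \<gamma>(4)[OF i] by simp
  moreover have "primitive_idempotent scale ?W (th_As \<Psi>) (\<theta>s ! i) (th_Es \<Psi> ! i)" if i: "i \<le> d" for i
    using primitive_idempotent_transport[OF e(2) i E(2)[OF i] e'(2) \<gamma>_End[OF E_End(2)[OF i]] S(1)]
      S(3)[OF E_End(2)[OF i]] \<gamma>(4)[OF i] by simp
  ultimately have "constructed_from scale d (X, \<theta>, \<theta>s) \<Psi>"
    unfolding constructed_from_def Let_def case_prod_conv
    using D' e' by (intro conjI exI[of _ "\<lambda>i. S (u i)"] exI[of _ "\<lambda>i. S (v i)"])
      (auto simp: eigenbasis_def)
  from constructed_from_rho_rep(2)[OF T(1) this] show ?thesis by (simp add: rho)
qed

lemma conjugation_algebra_iso: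
  assumes V: "subspace V" and W: "subspace W"
    and S: "lin_on scale V W S" and T: "lin_on scale W V T"
    and TS: "\<And>x. x \<in> V \<Longrightarrow> T (S x) = x" and ST: "\<And>y. y \<in> W \<Longrightarrow> S (T y) = y"
  shows "algebra_iso scale V W (\<lambda>f. \<lambda>y\<in>W. S (f (T y)))"
proof -
  have conj_End: "(\<lambda>y\<in>W. S (f (T y))) \<in> End scale W"
    if W: "subspace W" and S: "lin_on scale V W S" and T: "lin_on scale W V T" and f: "f \<in> End scale V"
    for V W S T f
    unfolding End_iff lin_on_def
    using lin_on_in[OF S] lin_on_in[OF T] EndD[OF f] lin_on_add[OF S] lin_on_add[OF T]
      lin_on_scale[OF S] lin_on_scale[OF T] subspace_add[OF W] subspace_scale[OF W]
    by auto
  note SW = lin_on_in[OF S] and TV = lin_on_in[OF T]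
  have inv: "(\<lambda>x\<in>V. T ((\<lambda>y\<in>W. S (f (T y))) (S x))) = f" if "f \<in> End scale V" for f
    using SW TS EndD(2,5)[OF that] by (intro extensionalityI[of _ V]) auto
  have inv': "(\<lambda>y\<in>W. S ((\<lambda>x\<in>V. T (g (S x))) (T y))) = g" if "g \<in> End scale W" for g
    using TV ST EndD(2,5)[OF that] by (intro extensionalityI[of _ W]) auto
  have "bij_betw (\<lambda>f. \<lambda>y\<in>W. S (f (T y))) (End scale V) (End scale W)"
    using inv inv' conj_End[OF W S T] conj_End[OF V T S]
    by (intro bij_betw_byWitness[where f' = "\<lambda>g. \<lambda>x\<in>V. T (g (S x))"]) auto
  then show ?thesis
    unfolding algebra_iso_def
    using TV SW TS ST lin_on_add[OF S] lin_on_scale[OF S]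
    by (auto simp: compose_def EndD(2) intro!: restrict_ext)
qed

text \<open>The linear map with \<open>u\<^sub>i \<mapsto> u'\<^sub>i\<close> also satisfies \<open>v\<^sub>j \<mapsto> v'\<^sub>j\<close>, because both pairs of bases are related by
  the same matrix. Conjugation by it matches \<open>A\<close> and \<open>E\<^sub>i\<close> on the first basis, and \<open>A\<^sup>*\<close> and \<open>E\<^sup>*\<^sub>i\<close> on
  the second.\<close>

lemma constructed_from_isomorphic:
  assumes w: "w \<in> nws_vandermonde d" and \<Phi>: "constructed_from scale d w \<Phi>"
    and \<Psi>: "constructed_from scale d w \<Psi>"
  shows "(\<Phi>, \<Psi>) \<in> TH_iso scale d"
proof -
  let ?V = "th_space \<Phi>" and ?W = "th_space \<Psi>"
  obtain X \<theta> \<theta>s where w_eq: "w = (X, \<theta>, \<theta>s)" by (cases w)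
  obtain u v where f: "eigenframe scale d \<Phi> (\<lambda>i. \<theta> ! i) u (\<lambda>i. \<theta>s ! i) v" and
    v: "\<And>j. j \<le> d \<Longrightarrow> v j = (\<Sum>i\<le>d. X $$ (i, j) *s u i)"
    using constructed_from_frame[OF w[unfolded w_eq] \<Phi>[unfolded w_eq]] by blast
  obtain u' v' where f': "eigenframe scale d \<Psi> (\<lambda>i. \<theta> ! i) u' (\<lambda>i. \<theta>s ! i) v'" and
    v': "\<And>j. j \<le> d \<Longrightarrow> v' j = (\<Sum>i\<le>d. X $$ (i, j) *s u' i)"
    using constructed_from_frame[OF w[unfolded w_eq] \<Psi>[unfolded w_eq]] by blast
  interpret F: idempotent_frame scale d ?V "th_A \<Phi>" "\<lambda>i. \<theta> ! i" u "\<lambda>i. th_E \<Phi> ! i"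
    by (rule eigenframe_idempotent_frames(1)[OF f])
  interpret Fs: idempotent_frame scale d ?V "th_As \<Phi>" "\<lambda>i. \<theta>s ! i" v "\<lambda>i. th_Es \<Phi> ! i"
    by (rule eigenframe_idempotent_frames(2)[OF f])
  interpret G: idempotent_frame scale d ?W "th_A \<Psi>" "\<lambda>i. \<theta> ! i" u' "\<lambda>i. th_E \<Psi> ! i"
    by (rule eigenframe_idempotent_frames(1)[OF f'])
  interpret Gs: idempotent_frame scale d ?W "th_As \<Psi>" "\<lambda>i. \<theta>s ! i" v' "\<lambda>i. th_Es \<Psi> ! i"
    by (rule eigenframe_idempotent_frames(2)[OF f'])
  obtain S where S: "lin_on scale ?V ?W S" "\<And>i. i \<le> d \<Longrightarrow> S (u i) = u' i"
    using lin_extend[OF F.ebD(1) G.ebD(2), of u'] G.ebD(6) by blast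
  obtain T where T: "lin_on scale ?W ?V T" "\<And>i. i \<le> d \<Longrightarrow> T (u' i) = u i"
    using lin_extend[OF G.ebD(1) F.ebD(2), of u] F.ebD(6) by blast
  have TS: "T (S x) = x" if "x \<in> ?V" for x
  proof (rule lin_on_eqI[OF F.ebD(1) _ _ _ that, where f = "\<lambda>x. T (S x)" and g = "\<lambda>x. x"])
    show "lin_on scale ?V ?V (\<lambda>x. T (S x))" "lin_on scale ?V ?V (\<lambda>x. x)"
      using S(1) T(1) by (auto simp: lin_on_def Pi_iff)
  qed (simp add: S T)
  have ST: "S (T y) = y" if "y \<in> ?W" for y
  proof (rule lin_on_eqI[OF G.ebD(1) _ _ _ that, where f = "\<lambda>y. S (T y)" and g = "\<lambda>y. y"])
    show "lin_on scale ?W ?W (\<lambda>y. S (T y))" "lin_on scale ?W ?W (\<lambda>y. y)"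
      using S(1) T(1) by (auto simp: lin_on_def Pi_iff)
  qed (simp add: S T)
  define \<gamma> where "\<gamma> f = (\<lambda>y\<in>?W. S (f (T y)))" for f
  have iso: "algebra_iso scale ?V ?W \<gamma>"
    unfolding \<gamma>_def by (rule conjugation_algebra_iso[OF F.ebD(2) G.ebD(2) S(1) T(1) TS ST])
  have \<gamma>_End: "\<gamma> f \<in> End scale ?W" if "f \<in> End scale ?V" for f
    using iso that by (auto simp: algebra_iso_def bij_betw_def)
  have Sv: "S (v j) = v' j" if "j \<le> d" for j
    using lin_on_comb[OF S(1) F.ebD(2), of "{..d}" u "\<lambda>i. X $$ (i, j)"] F.ebD(6) S(2) v[OF that] v'[OF that]
    by simp
  have Tv: "T (v' j) = v j" if "j \<le> d" for j
    using TS[OF Fs.ebD(6)[OF that]] Sv[OF that] by simp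
  have S0: "S 0 = 0" by (rule lin_on_0[OF S(1) F.ebD(2)])
  have "th_A \<Psi> = \<gamma> (th_A \<Phi>)"
    using G.ebD(6,8) F.ebD(6,8) T(2) S lin_on_scale[OF S(1)]
    by (intro End_eqI[OF G.ebD(1) G.ebD(4) \<gamma>_End[OF F.ebD(4)]]) (simp add: \<gamma>_def)
  moreover have "th_As \<Psi> = \<gamma> (th_As \<Phi>)"
    using Gs.ebD(6,8) Fs.ebD(6,8) Tv Sv lin_on_scale[OF S(1)]
    by (intro End_eqI[OF Gs.ebD(1) Gs.ebD(4) \<gamma>_End[OF Fs.ebD(4)]]) (simp add: \<gamma>_def)
  moreover have "th_E \<Psi> ! i = \<gamma> (th_E \<Phi> ! i)" if i: "i \<le> d" for i
    using G.ebD(6) G.E_u[OF i] F.E_u[OF i] T(2) S(2) S0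
    by (intro End_eqI[OF G.ebD(1) G.E_End[OF i] \<gamma>_End[OF F.E_End[OF i]]]) (simp add: \<gamma>_def)
  moreover have "th_Es \<Psi> ! i = \<gamma> (th_Es \<Phi> ! i)" if i: "i \<le> d" for i
    using Gs.ebD(6) Gs.E_u[OF i] Fs.E_u[OF i] Tv Sv S0
    by (intro End_eqI[OF Gs.ebD(1) Gs.E_End[OF i] \<gamma>_End[OF Fs.E_End[OF i]]]) (simp add: \<gamma>_def)
  ultimately show ?thesis
    unfolding TH_iso_def
    using iso constructed_from_rho_rep(1)[OF w \<Phi>] constructed_from_rho_rep(1)[OF w \<Psi>] by blast
qed

text \<open>Isomorphism amounts to equality of an invariant; in particular it is an equivalence relation.\<close>

lemma TH_iso_iff:
  "(\<Phi>, \<Psi>) \<in> TH_iso scale d \<longleftrightarrow>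
    \<Phi> \<in> TH_systems scale d \<and> \<Psi> \<in> TH_systems scale d \<and> rho_rep scale d \<Phi> = rho_rep scale d \<Psi>"
proof
  assume "(\<Phi>, \<Psi>) \<in> TH_iso scale d"
  then show "\<Phi> \<in> TH_systems scale d \<and> \<Psi> \<in> TH_systems scale d \<and> rho_rep scale d \<Phi> = rho_rep scale d \<Psi>"
    using TH_iso_rho_rep_eq by (auto simp: TH_iso_def)
next
  assume *: "\<Phi> \<in> TH_systems scale d \<and> \<Psi> \<in> TH_systems scale d \<and> rho_rep scale d \<Phi> = rho_rep scale d \<Psi>"
  then show "(\<Phi>, \<Psi>) \<in> TH_iso scale d"
    using transition_matrix_constructs[of \<Phi> d] transition_matrix_constructs[of \<Psi> d]
    by (intro constructed_from_isomorphic[of "rho_rep scale d \<Phi>"]) auto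
qed

lemma TH_iso_equiv: "equiv (TH_systems scale d) (TH_iso scale d)"
proof (rule equivI)
  show "TH_iso scale d \<subseteq> TH_systems scale d \<times> TH_systems scale d"
    by (auto simp: TH_iso_iff)
  show "refl_on (TH_systems scale d) (TH_iso scale d)"
    by (rule refl_onI) (simp add: TH_iso_iff)
  show "sym (TH_iso scale d)" by (rule symI) (simp add: TH_iso_iff)
  show "trans (TH_iso scale d)" by (rule transI) (simp add: TH_iso_iff)
qed

lemma rho_class:
  assumes "\<Phi> \<in> TH_systems scale d"
  shows "rho scale d (TH_class scale d \<Phi>) = rho_rep scale d \<Phi>"
proof -
  have "rho_rep scale d ` TH_class scale d \<Phi> = {rho_rep scale d \<Phi>}"
    using assms by (auto simp: TH_class_def TH_iso_iff)
  then show ?thesis by (simp add: rho_def)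
qed

lemma chi_class:
  assumes "w \<in> nws_vandermonde d" "constructed_from scale d w \<Phi>"
  shows "chi scale d w = TH_class scale d \<Phi>"
proof -
  have eq: "TH_class scale d \<Psi> = TH_class scale d \<Phi>" if "constructed_from scale d w \<Psi>" for \<Psi>
    using equiv_class_eq[OF TH_iso_equiv constructed_from_isomorphic[OF assms(1) that assms(2)]]
    by (simp add: TH_class_def)
  have "TH_class scale d ` {\<Phi>. constructed_from scale d w \<Phi>} = {TH_class scale d \<Phi>}"
  proof (intro equalityI subsetI)
    fix C assume "C \<in> TH_class scale d ` {\<Phi>. constructed_from scale d w \<Phi>}"
    then obtain \<Psi> where "constructed_from scale d w \<Psi>" "C = TH_class scale d \<Psi>" by blast
    then show "C \<in> {TH_class scale d \<Phi>}" using eq[of \<Psi>] by simp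
  qed (use assms(2) in blast)
  then show ?thesis by (simp add: chi_def)
qed

end

section \<open>The bijection\<close>

theorem theorem18p6:
  fixes scale :: "'a::field \<Rightarrow> 'v::ab_group_add \<Rightarrow> 'v" and d :: nat
  assumes "vector_space scale"
    and "\<exists>V. module.subspace scale V \<and> vector_space.dim scale V = Suc d"
  shows
    (* rho and chi are well defined *)
    "equiv (TH_systems scale d) (TH_iso scale d) \<and>
     (\<forall>\<Phi>\<in>TH_systems scale d. rho scale d (TH_class scale d \<Phi>) = rho_rep scale d \<Phi>) \<and>
     (\<forall>w\<in>nws_vandermonde d. \<exists>\<Phi>. constructed_from scale d w \<Phi>) \<and>
     (\<forall>w\<in>nws_vandermonde d. \<forall>\<Phi>. constructed_from scale d w \<Phi> \<longrightarrow>
        \<Phi> \<in> TH_systems scale d \<and> chi scale d w = TH_class scale d \<Phi>) \<and>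
     rho scale d \<in> TH_classes scale d \<rightarrow> nws_vandermonde d \<and>
     chi scale d \<in> nws_vandermonde d \<rightarrow> TH_classes scale d \<and>
     (\<forall>C\<in>TH_classes scale d. chi scale d (rho scale d C) = C) \<and>
     (\<forall>w\<in>nws_vandermonde d. rho scale d (chi scale d w) = w) \<and>
     bij_betw (rho scale d) (TH_classes scale d) (nws_vandermonde d) \<and>
     bij_betw (chi scale d) (nws_vandermonde d) (TH_classes scale d)"
proof -
  interpret vector_space scale by (rule assms(1))
  obtain V where V: "subspace V" "dim V = Suc d" using assms(2) by blast
  have exists: "\<exists>\<Phi>. constructed_from scale d w \<Phi>" if "w \<in> nws_vandermonde d" for w
    using constructed_from_exists[OF V] that by (cases w) auto
  have class_mem: "TH_class scale d \<Phi> \<in> TH_classes scale d" if "\<Phi> \<in> TH_systems scale d" for \<Phi>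
    using that by (auto simp: TH_class_def TH_classes_def intro: quotientI)
  have class_cases: "\<exists>\<Phi>\<in>TH_systems scale d. C = TH_class scale d \<Phi>" if "C \<in> TH_classes scale d" for C
    using that by (auto simp: TH_class_def TH_classes_def elim!: quotientE)
  have rho_in: "rho scale d C \<in> nws_vandermonde d" if "C \<in> TH_classes scale d" for C
    using class_cases[OF that] rho_class transition_matrix_constructs(1) by auto
  have chi_rho: "chi scale d (rho scale d C) = C" if C: "C \<in> TH_classes scale d" for C
  proof -
    obtain \<Phi> where \<Phi>: "\<Phi> \<in> TH_systems scale d" "C = TH_class scale d \<Phi>" using class_cases[OF C] ..
    then show ?thesis
      using rho_class[OF \<Phi>(1)] chi_class[OF transition_matrix_constructs[OF \<Phi>(1)]] by simp
  qed
  have chi: "chi scale d w \<in> TH_classes scale d \<and> rho scale d (chi scale d w) = w"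
    if w: "w \<in> nws_vandermonde d" for w
  proof -
    obtain \<Phi> where \<Phi>: "constructed_from scale d w \<Phi>" using exists[OF w] ..
    note R = constructed_from_rho_rep[OF w \<Phi>]
    show ?thesis using chi_class[OF w \<Phi>] class_mem[OF R(1)] rho_class[OF R(1)] R(2) by simp
  qed
  have "bij_betw (rho scale d) (TH_classes scale d) (nws_vandermonde d)"
    using rho_in chi_rho chi by (intro bij_betw_byWitness[where f' = "chi scale d"]) auto
  moreover have "bij_betw (chi scale d) (nws_vandermonde d) (TH_classes scale d)"
    using rho_in chi_rho chi by (intro bij_betw_byWitness[where f' = "rho scale d"]) auto
  ultimately show ?thesis
    using TH_iso_equiv rho_class exists constructed_from_rho_rep(1) chi_class rho_in chi chi_rho
    by blast
qed

end
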